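(* Every classical convex cap of dimension $3$ is infinitesimally rigid, in the following sense: for every triangulation of the non-base faces of $C$ by diagonals, every infinitesimal flex of $C$ is the restriction to the vertices of an infinitesimal rigid motion of $\mathbb{R}^3$ preserving the horizontal plane.
   Context: Let $\mathbb{R}^3_+=\{z\ge0\}$. A (classical) convex cap is a convex polytope $C\subset\mathbb{R}^3$ with $C\subset\mathbb{R}^3_+$, $C\cap\{z=0\}\neq\emptyset$ (this face is the base), such that the vertical projection to $\{z=0\}$ maps $C$ onto its base, and $\dim C\in\{2,3\}$. Let $p_1,\dots,p_m$ be the vertices of $C$, and triangulate each face of $C$ other than the base by diagonals. An infinitesimal flex of $C$ is a collection of vectors $p'_1,\dots,p'_m\in\mathbb{R}^3$ such that $(p'_i-p'_j)\cdot(p_i-p_j)=0$ whenever $p_ip_j$ is an edge of this triangulation (an edge of $C$ not in the relative interior of the base, or an added diagonal), and $p'_i$ is horizontal (has zero $z$-component) whenever $p_i$ lies in the plane $\{z=0\}$. An infinitesimal rigid motion preserving the horizontal plane is a vector field $p\mapsto a\times p+b$ with $a$ vertical and $b$ horizontal. *)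

theory Defs
  imports "HOL-Analysis.Analysis" "HOL-Analysis.Cross3"
begin

definition vproj :: "real^3 \<Rightarrow> real^3" where
  "vproj x = (\<chi> i. if i = 3 then 0 else x $ i)"

definition cap_base :: "(real^3) set \<Rightarrow> (real^3) set" where
  "cap_base C = C \<inter> {x. x $ 3 = 0}"

definition convex_cap :: "(real^3) set \<Rightarrow> bool" where
  "convex_cap C \<longleftrightarrow> polytope C \<and> C \<subseteq> {x. x $ 3 \<ge> 0} \<and> cap_base C \<noteq> {}
     \<and> vproj ` C = cap_base C \<and> aff_dim C \<in> {2, 3}"

definition cap_vertices :: "(real^3) set \<Rightarrow> (real^3) set" where
  "cap_vertices C = {v. v extreme_point_of C}"

definition nonbase_faces :: "(real^3) set \<Rightarrow> (real^3) set set" where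
  "nonbase_faces C = {F. F face_of C \<and> aff_dim F = 2 \<and> F \<noteq> cap_base C}"

definition diag_triangulation :: "(real^3) set \<Rightarrow> ((real^3) set \<Rightarrow> (real^3) set set) \<Rightarrow> bool" where
  "diag_triangulation C tri \<longleftrightarrow>
     (\<forall>F \<in> nonbase_faces C.
        (\<forall>t \<in> tri F. t \<subseteq> {v. v extreme_point_of F} \<and> card t = 3) \<and>
        \<Union> ((\<lambda>t. convex hull t) ` tri F) = F \<and>
        (\<forall>t \<in> tri F. \<forall>t' \<in> tri F. t \<noteq> t' \<longrightarrow>
            rel_interior (convex hull t) \<inter> rel_interior (convex hull t') = {}))"

definition cap_bars :: "(real^3) set \<Rightarrow> ((real^3) set \<Rightarrow> (real^3) set set) \<Rightarrow> ((real^3, real^3) prod) set" where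
  "cap_bars C tri =
     {(p, q). p \<in> cap_vertices C \<and> q \<in> cap_vertices C \<and> p \<noteq> q \<and>
        ((closed_segment p q face_of C \<and> \<not> closed_segment p q \<subseteq> rel_interior (cap_base C)) \<or>
         (\<exists>F \<in> nonbase_faces C. \<exists>t \<in> tri F. {p, q} \<subseteq> t))}"

definition inf_flex :: "(real^3) set \<Rightarrow> ((real^3) set \<Rightarrow> (real^3) set set) \<Rightarrow> (real^3 \<Rightarrow> real^3) \<Rightarrow> bool" where
  "inf_flex C tri v \<longleftrightarrow>
     (\<forall>(p, q) \<in> cap_bars C tri. (v p - v q) \<bullet> (p - q) = 0) \<and>
     (\<forall>p \<in> cap_vertices C. p $ 3 = 0 \<longrightarrow> v p $ 3 = 0)"

definition horiz_rigid_motion :: "(real^3 \<Rightarrow> real^3) \<Rightarrow> bool" where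
  "horiz_rigid_motion m \<longleftrightarrow>
     (\<exists>a b. a $ 1 = 0 \<and> a $ 2 = 0 \<and> b $ 3 = 0 \<and> (\<forall>p. m p = cross3 a p + b))"

end

theory Submission
  imports Defs
begin

text \<open>
  Project the non-vertical facets to the base plane and write the flex as \<open>(w, z)\<close> with
  \<open>w\<close> horizontal and \<open>z\<close> vertical. On each triangle the height
  \<open>H\<close> and \<open>z\<close> are affine, with gradients \<open>g\<close> and
  \<open>c\<close>. For an oriented triangle with edge \<open>p q\<close> put
  \<open>X = (g \<times> c) (z q - z p) - c \<times> (w q - w p)\<close>. Summed around a triangle
  \<open>X\<close> vanishes, whereas the two contributions of an interior edge add up to
  \<open>- s (z q - z p)\<^sup>2\<close>, where \<open>s \<le> 0\<close> measures the jump of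
  \<open>g\<close> across the edge (concavity of the cap). Boundary edges contribute nothing: a
  vertical facet is rigid in its own plane and its base edge stays horizontal, so
  \<open>z = 0\<close> over the boundary of the base. Hence \<open>z p = z q\<close> along every
  true edge. If \<open>z\<close> were not zero, an extreme vertex in the \<open>x\<close>-direction
  among those with \<open>z \<noteq> 0\<close> would have no true edge in a half disc around it,
  hence would not be a vertex of the cap. So \<open>z = 0\<close>, and \<open>w\<close> is a flex of
  a planar triangulated convex polygon, which is a rigid motion because neighbouring triangles share
  an edge and a convex region minus finitely many points is connected.
\<close>

section \<open>Oriented triangles in the plane\<close>

definition cross2 :: "real \<times> real \<Rightarrow> real \<times> real \<Rightarrow> real" where
  "cross2 u v = fst u * snd v - snd u * fst v"

definition orient :: "real \<times> real \<Rightarrow> real \<times> real \<Rightarrow> real \<times> real \<Rightarrow> real" where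
  "orient p q r = cross2 (q - p) (r - p)"

lemma orient_cycle: "orient q r p = orient p q r"
  by (simp add: orient_def cross2_def algebra_simps)

lemma orient_swap: "orient q p r = - orient p q r"
  by (simp add: orient_def cross2_def algebra_simps)

text \<open>\<open>orient p q\<close> is affine in its third argument and vanishes at
  \<open>p\<close> and \<open>q\<close>, so only the weight of \<open>r\<close> survives.\<close>

lemma orient_barycentric:
  assumes "u + v + w = 1"
  shows "orient p q (u *\<^sub>R p + v *\<^sub>R q + w *\<^sub>R r) = w * orient p q r"
proof -
  have u: "u = 1 - v - w" using assms by simp
  show ?thesis unfolding u by (simp add: orient_def cross2_def algebra_simps)
qed

text \<open>Cramer's rule: the weights are the signed areas of the three subtriangles cut out by
  \<open>x\<close>, divided by that of the whole triangle.\<close>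

lemma barycentric_orient:
  assumes "orient p q r \<noteq> 0"
  shows "x = (orient q r x / orient p q r) *\<^sub>R p + (orient r p x / orient p q r) *\<^sub>R q
           + (orient p q x / orient p q r) *\<^sub>R r"
    and "orient q r x / orient p q r + orient r p x / orient p q r + orient p q x / orient p q r = 1"
proof -
  let ?D = "orient p q r"
  have 1: "?D * fst x = orient q r x * fst p + orient r p x * fst q + orient p q x * fst r"
    and 2: "?D * snd x = orient q r x * snd p + orient r p x * snd q + orient p q x * snd r"
    and 3: "orient q r x + orient r p x + orient p q x = ?D"
    by (simp_all add: orient_def cross2_def algebra_simps)
  show "x = (orient q r x / ?D) *\<^sub>R p + (orient r p x / ?D) *\<^sub>R q + (orient p q x / ?D) *\<^sub>R r"
    using 1 2 assms by (simp add: prod_eq_iff field_simps)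
  show "orient q r x / ?D + orient r p x / ?D + orient p q x / ?D = 1"
    using 3 assms by (simp add: add_divide_distrib[symmetric])
qed

lemma orient_nonzero_not_collinear:
  assumes "orient p q r \<noteq> 0"
  shows "\<not> collinear {p, q, r}"
proof
  assume "collinear {p, q, r}"
  then obtain u where u: "\<forall>x\<in>{p,q,r}. \<forall>y\<in>{p,q,r}. \<exists>c. x - y = c *\<^sub>R u"
    unfolding collinear_def by blast
  then obtain a b where "q - p = a *\<^sub>R u" "r - p = b *\<^sub>R u" by blast
  then have "orient p q r = 0" by (simp add: orient_def cross2_def)
  then show False using assms by simp
qed

text \<open>A vanishing determinant gives collinearity, also when points coincide, and of three
  collinear points one lies between the other two.\<close>

lemma orient_zero_between:
  assumes "orient p q r = 0"
  shows "p \<in> closed_segment q r \<or> q \<in> closed_segment r p \<or> r \<in> closed_segment p q"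
proof -
  have "collinear {p, q, r}"
  proof (cases "q = p")
    case True then show ?thesis by simp
  next
    case False
    define e where "e = q - p"
    have "e \<noteq> 0" using False by (simp add: e_def)
    then have ee: "e \<bullet> e \<noteq> 0" by simp
    \<comment> \<open>Since the cross product vanishes, \<open>r - p\<close> equals its own
      projection onto \<open>e\<close>; this is written without division.\<close>
    have "(e \<bullet> e) *\<^sub>R (r - p) = (e \<bullet> (r - p)) *\<^sub>R e"
      using assms unfolding orient_def e_def[symmetric]
      by (simp add: cross2_def inner_prod_def prod_eq_iff algebra_simps) algebra
    then have "r - p = ((e \<bullet> (r - p)) / (e \<bullet> e)) *\<^sub>R e"
      using ee by (metis (no_types, lifting) divideR_right divide_inverse_commute scaleR_scaleR)
    then have "r = p + ((e \<bullet> (r - p)) / (e \<bullet> e)) *\<^sub>R (q - p)"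
      unfolding e_def by (simp add: algebra_simps)
    then have "\<exists>u. r = u *\<^sub>R p + (1 - u) *\<^sub>R q"
      by (intro exI[of _ "1 - (e \<bullet> (r - p)) / (e \<bullet> e)"]) (simp add: algebra_simps)
    then have "collinear {p, r, q}"
      by (subst collinear_3_expand) auto
    then show ?thesis by (simp add: insert_commute)
  qed
  then show ?thesis
    by (auto simp: collinear_between_cases between_mem_segment)
qed

text \<open>The three orientations are positive multiples of the barycentric coordinates, so
  membership is a sign condition on each side line.\<close>

lemma mem_triangle_iff:
  assumes "orient p q r > 0"
  shows "x \<in> convex hull {p, q, r} \<longleftrightarrow> 0 \<le> orient p q x
      \<and> 0 \<le> orient q r x \<and> 0 \<le> orient r p x"
proof
  assume "x \<in> convex hull {p, q, r}"
  then obtain u v w where uvw: "0 \<le> u" "0 \<le> v" "0 \<le> w" "u + v + w = 1"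
    "x = u *\<^sub>R p + v *\<^sub>R q + w *\<^sub>R r"
    unfolding convex_hull_3 by blast
  have "orient p q x = w * orient p q r"
    using orient_barycentric[OF uvw(4)] uvw(5) by simp
  moreover have "orient q r x = u * orient p q r"
    using orient_barycentric[of v w u q r p] uvw(4,5) by (simp add: ac_simps orient_cycle)
  moreover have "orient r p x = v * orient p q r"
    using orient_barycentric[of w u v r p q] uvw(4,5) by (simp add: ac_simps orient_cycle[of p q r])
  ultimately show "0 \<le> orient p q x \<and> 0 \<le> orient q r x \<and> 0 \<le> orient r p x"
    using uvw assms by simp
next
  assume "0 \<le> orient p q x \<and> 0 \<le> orient q r x \<and> 0 \<le> orient r p x"
  then show "x \<in> convex hull {p, q, r}"
    unfolding convex_hull_3 using barycentric_orient[of p q r x] assms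
    by (intro CollectI exI[of _ "orient q r x / orient p q r"] exI[of _ "orient r p x / orient p q r"]
        exI[of _ "orient p q x / orient p q r"]) simp
qed

lemma mem_interior_triangle_iff:
  assumes "orient p q r > 0"
  shows "x \<in> interior (convex hull {p, q, r}) \<longleftrightarrow> 0 < orient p q x
      \<and> 0 < orient q r x \<and> 0 < orient r p x"
proof -
  have nc: "\<not> collinear {p, q, r}" using assms by (intro orient_nonzero_not_collinear) simp
  have int: "interior (convex hull {p, q, r}) =
     {v. \<exists>x y z. 0 < x \<and> 0 < y \<and> 0 < z \<and> x + y + z = 1
         \<and> x *\<^sub>R p + y *\<^sub>R q + z *\<^sub>R r = v}"
    by (rule interior_convex_hull_3_minimal[OF nc]) simp
  show ?thesis
  proof
    assume "x \<in> interior (convex hull {p, q, r})"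
    then obtain u v w where uvw: "0 < u" "0 < v" "0 < w" "u + v + w = 1"
      "x = u *\<^sub>R p + v *\<^sub>R q + w *\<^sub>R r"
      unfolding int by blast
    have "orient p q x = w * orient p q r"
      using orient_barycentric[OF uvw(4)] uvw(5) by simp
    moreover have "orient q r x = u * orient p q r"
      using orient_barycentric[of v w u q r p] uvw(4,5) by (simp add: ac_simps orient_cycle)
    moreover have "orient r p x = v * orient p q r"
      using orient_barycentric[of w u v r p q] uvw(4,5) by (simp add: ac_simps orient_cycle[of p q r])
    ultimately show "0 < orient p q x \<and> 0 < orient q r x \<and> 0 < orient r p x"
      using uvw assms by simp
  next
    assume "0 < orient p q x \<and> 0 < orient q r x \<and> 0 < orient r p x"
    then show "x \<in> interior (convex hull {p, q, r})"
      unfolding int using barycentric_orient[of p q r x] assms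
      by (intro CollectI exI[of _ "orient q r x / orient p q r"] exI[of _ "orient r p x / orient p q r"]
          exI[of _ "orient p q x / orient p q r"]) simp
  qed
qed

lemma interior_triangle_nonempty:
  assumes "orient p q r > 0"
  shows "interior (convex hull {p, q, r}) \<noteq> {}"
proof -
  let ?c = "(1/3) *\<^sub>R p + (1/3) *\<^sub>R q + (1/3) *\<^sub>R r"
  have "orient p q ?c = 1/3 * orient p q r" "orient q r ?c = 1/3 * orient p q r"
    "orient r p ?c = 1/3 * orient p q r"
    by (simp_all add: orient_def cross2_def field_simps)
  then have "?c \<in> interior (convex hull {p, q, r})"
    using assms unfolding mem_interior_triangle_iff[OF assms] by linarith
  then show ?thesis by blast
qed

text \<open>If \<open>e\<close> and \<open>f\<close> are independent, a vector to the left of both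
  comes from a linear system; if they are parallel in the same sense, a normal serves. This later
  forces two non-overlapping triangles on one edge to run along it in opposite directions.\<close>

lemma no_common_left_side:
  assumes "e \<noteq> 0" "\<And>u. \<not> (cross2 e u > 0 \<and> cross2 f u > 0)" "f \<noteq> 0"
  obtains k where "k > 0" "f = - k *\<^sub>R e"
proof -
  have ee: "fst e * fst e + snd e * snd e > 0" "fst f * fst f + snd f * snd f > 0"
    using assms(1,3) by (auto simp: prod_eq_iff sum_squares_gt_zero_iff)
  have cr0: "cross2 e f = 0"
  proof (rule ccontr)
    assume ne: "cross2 e f \<noteq> 0"
    \<comment> \<open>Solution of the system \<open>cross2 e u = 1\<close>,
      \<open>cross2 f u = 1\<close>.\<close>
    define u where "u = (1 / cross2 e f) *\<^sub>R (f - e)"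
    have "cross2 e (f - e) = cross2 e f" "cross2 f (f - e) = cross2 e f"
        by (simp_all add: cross2_def algebra_simps)
    moreover have "cross2 x (c *\<^sub>R y) = c * cross2 x y" for c x y
        by (simp add: cross2_def algebra_simps)
    ultimately have "cross2 e u = (1 / cross2 e f) * cross2 e f" "cross2 f u = (1 / cross2 e f) * cross2 e f"
      unfolding u_def by simp_all
    then have "cross2 e u = 1" "cross2 f u = 1" using ne by simp_all
    then show False using assms(2)[of u] by simp
  qed
  define N where "N = fst e * fst e + snd e * snd e"
  have N: "N > 0" using ee by (simp add: N_def)
  define k where "k = - (fst e * fst f + snd e * snd f) / N"
  have "N * fst f = (fst e * fst f + snd e * snd f) * fst e"
    "N * snd f = (fst e * fst f + snd e * snd f) * snd e"
    using cr0 unfolding cross2_def N_def by algebra+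
  then have f: "f = - k *\<^sub>R e"
    using N by (simp add: k_def prod_eq_iff field_simps)
  have "k > 0"
  proof (rule ccontr)
    assume "\<not> k > 0"
    moreover have "k \<noteq> 0" using f assms(3) by auto
    ultimately have k: "- k > 0" by simp
    \<comment> \<open>The left normal of \<open>e\<close>, which is also to the left of any positive
      multiple of \<open>e\<close>.\<close>
    let ?u = "(- snd e, fst e)"
    have 1: "cross2 e ?u > 0" using ee by (simp add: cross2_def)
    have "cross2 f ?u = - k * cross2 e ?u" unfolding f by (simp add: cross2_def algebra_simps)
    then have "cross2 f ?u > 0" using mult_pos_pos[OF k 1] by simp
    then show False using 1 assms(2) by blast
  qed
  then show ?thesis using that f by blast
qed

lemma mem_open_segment_add:
  fixes p q :: "'a::real_vector"
  assumes "p \<noteq> q" "0 < s" "s < 1"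
  shows "p + s *\<^sub>R (q - p) \<in> open_segment p q"
  using assms unfolding in_segment by (auto intro!: exI[of _ s] simp: algebra_simps)

text \<open>Counterclockwise quarter turn; the infinitesimal rigid motions of the plane are the
  fields \<open>b + k *\<^sub>R perp x\<close>.\<close>

definition perp :: "real \<times> real \<Rightarrow> real \<times> real" where
  "perp x = (- snd x, fst x)"

lemma perp_diff: "perp (x - y) = perp x - perp y"
  by (simp add: perp_def)

lemma orthogonal_imp_perp:
  assumes "a \<bullet> e = 0" "e \<noteq> 0"
  obtains k where "a = k *\<^sub>R perp e"
proof
  define N where "N = fst e * fst e + snd e * snd e"
  have N: "N > 0"
    using assms(2) by (auto simp: prod_eq_iff sum_squares_gt_zero_iff N_def)
  have "N * fst a = - cross2 e a * snd e" "N * snd a = cross2 e a * fst e"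
    using assms(1) unfolding cross2_def inner_prod_def inner_real_def N_def by algebra+
  then show "a = (cross2 e a / N) *\<^sub>R perp e"
    using N by (simp add: prod_eq_iff perp_def field_simps)
qed

section \<open>Triangulated convex regions\<close>

text \<open>Vertices are labels placed in the plane by \<open>pos\<close>, because vertices in space
  are later projected in more than one way. The axiom \<open>vertex\<close> forbids a corner of one
  triangle from sitting on another triangle that does not have it as a corner; the edge-to-edge
  property is derived from it in \<open>edge_shared\<close>.\<close>

locale triangulated_region =
  fixes pos :: "'a \<Rightarrow> real \<times> real" and T :: "'a set set"
  assumes finite_T: "finite T"
    and triangle: "t \<in> T \<Longrightarrow> \<exists>p q r. t = {p, q, r}
        \<and> orient (pos p) (pos q) (pos r) > 0"
    and disjoint: "\<lbrakk>t \<in> T; t' \<in> T; t \<noteq> t'\<rbrakk> \<Longrightarrow>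
      interior (convex hull (pos ` t)) \<inter> interior (convex hull (pos ` t')) = {}"
    and vertex: "\<lbrakk>t \<in> T; t' \<in> T; p \<in> t'; pos p \<in> convex hull (pos ` t)\<rbrakk>
        \<Longrightarrow> p \<in> t"
    and convex_region: "convex (\<Union>t\<in>T. convex hull (pos ` t))"
begin

abbreviation cell :: "'a set \<Rightarrow> (real \<times> real) set" where
  "cell t \<equiv> convex hull (pos ` t)"

definition region :: "(real \<times> real) set" where
  "region = (\<Union>t\<in>T. cell t)"

text \<open>Each triangle occurs three times, once for each rotation of its labels, so the elements
  are the directed sides \<open>p q\<close> together with the apex \<open>r\<close> on their
  left.\<close>

definition oriented :: "('a \<times> 'a \<times> 'a) set" where
  "oriented = {(p, q, r). {p, q, r} \<in> T \<and> orient (pos p) (pos q) (pos r) > 0}"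

lemma oriented_cycle: "(p, q, r) \<in> oriented \<Longrightarrow> (q, r, p) \<in> oriented"
  by (simp add: oriented_def orient_cycle insert_commute)

lemma obtain_oriented:
  assumes "t \<in> T"
  obtains p q r where "(p, q, r) \<in> oriented" "t = {p, q, r}"
  using triangle[OF assms] assms unfolding oriented_def by blast

lemma orientedD:
  assumes "(p, q, r) \<in> oriented"
  shows "{p, q, r} \<in> T" "orient (pos p) (pos q) (pos r) > 0" "pos p \<noteq> pos q" "pos q \<noteq> pos r" "pos r \<noteq> pos p"
  using assms by (auto simp: oriented_def orient_def cross2_def)

lemma finite_vertices: "finite (\<Union>T)"
  using finite_T triangle by (metis finite.emptyI finite_Union finite_insert)

lemma finite_oriented: "finite oriented"
proof (rule finite_subset)
  show "oriented \<subseteq> \<Union>T \<times> \<Union>T \<times> \<Union>T" by (auto simp: oriented_def)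
  show "finite (\<Union>T \<times> \<Union>T \<times> \<Union>T)" using finite_vertices by blast
qed

lemma finite_cell_vertices: "t \<in> T \<Longrightarrow> finite t"
  using triangle by fastforce

lemma compact_cell: "t \<in> T \<Longrightarrow> compact (cell t)"
  by (simp add: finite_cell_vertices finite_imp_compact_convex_hull)

lemma mem_cell_iff:
  assumes "(p, q, r) \<in> oriented"
  shows "x \<in> cell {p, q, r} \<longleftrightarrow> 0 \<le> orient (pos p) (pos q) x
      \<and> 0 \<le> orient (pos q) (pos r) x \<and> 0 \<le> orient (pos r) (pos p) x"
  using mem_triangle_iff[OF orientedD(2)[OF assms]] by simp

lemma mem_interior_cell_iff:
  assumes "(p, q, r) \<in> oriented"
  shows "x \<in> interior (cell {p, q, r}) \<longleftrightarrow> 0 < orient (pos p) (pos q) x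
      \<and> 0 < orient (pos q) (pos r) x \<and> 0 < orient (pos r) (pos p) x"
  using mem_interior_triangle_iff[OF orientedD(2)[OF assms]] by simp

lemma interior_cell_nonempty:
  assumes "t \<in> T"
  shows "interior (cell t) \<noteq> {}"
proof -
  obtain p q r where o: "(p, q, r) \<in> oriented" and t: "t = {p, q, r}"
    using assms obtain_oriented by metis
  show ?thesis using interior_triangle_nonempty[OF orientedD(2)[OF o]] by (simp add: t)
qed

lemma closure_interior_cell: "t \<in> T \<Longrightarrow> closure (interior (cell t)) = cell t"
  by (metis convex_closure_interior convex_convex_hull interior_cell_nonempty compact_cell
      compact_imp_closed closure_closed)

text \<open>A cell is the closure of its interior, so an open set that meets the cell also meets its
  interior, and interiors are disjoint.\<close>

lemma interior_cell_unique:
  assumes "t \<in> T" "t' \<in> T" "x \<in> interior (cell t)" "x \<in> cell t'"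
  shows "t = t'"
proof (rule ccontr)
  assume "t \<noteq> t'"
  have "x \<in> closure (interior (cell t'))" using assms closure_interior_cell by simp
  then have "interior (cell t) \<inter> interior (cell t') \<noteq> {}"
    using assms(3) open_Int_closure_eq_empty[OF open_interior] by blast
  then show False using disjoint[OF assms(1,2) \<open>t \<noteq> t'\<close>] by blast
qed

text \<open>Outside the interior some barycentric coordinate vanishes; a rotation of the labels
  makes the side in question the first one.\<close>

lemma cell_cases:
  assumes "t \<in> T" "x \<in> cell t"
  obtains (interior) "x \<in> interior (cell t)"
  | (vertex) p where "p \<in> t" "x = pos p"
  | (edge) p q r where "(p, q, r) \<in> oriented" "t = {p, q, r}" "x \<in> open_segment (pos p) (pos q)"
proof -
  obtain p q r where o: "(p, q, r) \<in> oriented" and t: "t = {p, q, r}"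
    using assms obtain_oriented by metis
  have edge: "(\<exists>y\<in>{a, b, c}. x = pos y) \<or> x \<in> open_segment (pos a) (pos b)"
    if o: "(a, b, c) \<in> oriented" and x: "x \<in> cell {a, b, c}"
        and 0: "orient (pos a) (pos b) x = 0" for a b c
  proof -
    let ?D = "orient (pos a) (pos b) (pos c)"
    define u where "u = orient (pos b) (pos c) x / ?D"
    define v where "v = orient (pos c) (pos a) x / ?D"
    have D: "?D > 0" using orientedD[OF o] by simp
    have uv: "0 \<le> u" "0 \<le> v" using x mem_cell_iff[OF o] D by (auto simp: u_def v_def)
    have "x = u *\<^sub>R pos a + v *\<^sub>R pos b" "u + v = 1"
      using barycentric_orient[of "pos a" "pos b" "pos c" x] D 0 by (auto simp: u_def v_def)
    moreover from this have "u = 1 - v" by simp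
    ultimately have "x \<in> closed_segment (pos a) (pos b)"
      using uv unfolding closed_segment_def by auto
    then show ?thesis unfolding open_segment_def by blast
  qed
  show thesis
  proof (cases "x \<in> interior (cell t)")
    case True then show ?thesis by (rule interior)
  next
    case False
    have o2: "(q, r, p) \<in> oriented" "(r, p, q) \<in> oriented" using o oriented_cycle by blast+
    have t2: "t = {q, r, p}" "t = {r, p, q}" using t by auto
    consider "orient (pos p) (pos q) x = 0" | "orient (pos q) (pos r) x = 0" | "orient (pos r) (pos p) x = 0"
      using False assms(2) mem_cell_iff[OF o, of x] mem_interior_cell_iff[OF o, of x] unfolding t by linarith
    then show ?thesis
    proof cases
      case 1 then show ?thesis using edge[OF o] o t assms(2) vertex that(3) by metis
    next
      case 2 then show ?thesis using edge[OF o2(1)] o2 t2 assms(2) vertex that(3) by metis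
    next
      case 3 then show ?thesis using edge[OF o2(2)] o2 t2 assms(2) vertex that(3) by metis
    qed
  qed
qed

text \<open>Along a direction pointing left of the side, the orientation with respect to that side
  grows linearly from zero, and the other two start positive and stay so for a short time.\<close>

lemma eventually_interior_cell:
  assumes o: "(p, q, r) \<in> oriented" and x: "x \<in> open_segment (pos p) (pos q)"
    and u: "cross2 (pos q - pos p) u > 0"
  shows "\<forall>\<^sub>F e in at_right 0. x + e *\<^sub>R u \<in> interior (cell {p, q, r})"
proof -
  obtain l where l: "0 < l" "l < 1" and xl: "x = (1 - l) *\<^sub>R pos p + l *\<^sub>R pos q"
    using x unfolding in_segment by blast
  let ?D = "orient (pos p) (pos q) (pos r)"
  have D: "?D > 0" using orientedD[OF o] by simp
  have a: "orient (pos q) (pos r) x = (1 - l) * ?D" "orient (pos r) (pos p) x = l * ?D"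
    unfolding xl by (simp_all add: orient_def cross2_def algebra_simps)
  have eq: "orient (pos p) (pos q) (x + e *\<^sub>R u) = e * cross2 (pos q - pos p) u"
    "orient (pos q) (pos r) (x + e *\<^sub>R u) = (1 - l) * ?D + e * cross2 (pos r - pos q) u"
    "orient (pos r) (pos p) (x + e *\<^sub>R u) = l * ?D + e * cross2 (pos p - pos r) u" for e
    unfolding a[symmetric] xl by (simp_all add: orient_def cross2_def algebra_simps)
  have 1: "\<forall>\<^sub>F e in at_right 0. 0 < e * cross2 (pos q - pos p) u"
    using u by (simp add: eventually_at_right_field) (meson zero_less_mult_iff zero_less_one)
  have pos: "\<forall>\<^sub>F e in at_right 0. 0 < c + e * k" if "0 < c" for c k :: real
  proof -
    have "((\<lambda>e. c + e * k) \<longlongrightarrow> c + 0 * k) (at_right 0)" by (intro tendsto_intros)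
    then show ?thesis using that by (intro order_tendstoD(1)) auto
  qed
  have 2: "\<forall>\<^sub>F e in at_right 0. 0 < (1 - l) * ?D + e * cross2 (pos r - pos q) u"
    "\<forall>\<^sub>F e in at_right 0. 0 < l * ?D + e * cross2 (pos p - pos r) u"
    using l D by (auto intro!: pos)
  show ?thesis
    using 1 2 by eventually_elim (simp only: mem_interior_cell_iff[OF o] eq simp_thms)
qed

section \<open>Neighbouring triangles across an edge\<close>

lemma edge_subset_cell: "open_segment (pos p) (pos q) \<subseteq> cell {p, q, r}"
  by (metis convex_convex_hull convex_contains_open_segment hull_inc imageI insertCI)

text \<open>By \<open>vertex\<close>, a second label at the same place would be a corner of the same
  triangle, whose corners have distinct positions.\<close>

lemma pos_inj:
  assumes "p \<in> \<Union>T" "q \<in> \<Union>T" "pos p = pos q"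
  shows "p = q"
proof -
  obtain t where t: "t \<in> T" "p \<in> t" using assms by blast
  have "pos q \<in> cell t" using t assms(3) by (metis hull_inc imageI)
  then have "q \<in> t" using vertex t assms(2) by blast
  obtain a b c where "(a, b, c) \<in> oriented" "t = {a, b, c}" using obtain_oriented t by metis
  then show ?thesis using orientedD[of a b c] t(2) \<open>q \<in> t\<close> assms(3) by auto
qed

text \<open>By \<open>vertex\<close>, a vertex inside a side would be a corner of that triangle, but
  the ends are not inside the side and the apex is off its line.\<close>

lemma edge_not_vertex:
  assumes o: "(p, q, r) \<in> oriented" and x: "x \<in> open_segment (pos p) (pos q)" and "y \<in> \<Union>T"
  shows "x \<noteq> pos y"
proof
  assume xy: "x = pos y"
  have "x \<in> cell {p, q, r}" using x edge_subset_cell by blast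
  then have "y \<in> {p, q, r}"
    using vertex[OF orientedD(1)[OF o]] assms(3) xy by blast
  moreover have "x \<noteq> pos p" "x \<noteq> pos q" using x by (auto simp: open_segment_def)
  moreover have "x \<noteq> pos r"
  proof
    assume "x = pos r"
    obtain l where xl: "x = (1 - l) *\<^sub>R pos p + l *\<^sub>R pos q"
      using x unfolding in_segment by blast
    have "orient (pos p) (pos q) x = 0" unfolding xl by (simp add: orient_def cross2_def algebra_simps)
    then show False using orientedD(2)[OF o] \<open>x = pos r\<close> by simp
  qed
  ultimately show False using xy by auto
qed

text \<open>The point must lie inside a side of \<open>t'\<close> as well. Disjoint interiors make
  the two sides antiparallel, and neither contains an endpoint of the other in its inside, so they
  coincide with reversed direction.\<close>

lemma edge_shared:
  assumes o: "(p, q, r) \<in> oriented" and x: "x \<in> open_segment (pos p) (pos q)"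
    and t': "t' \<in> T" "x \<in> cell t'" "t' \<noteq> {p, q, r}"
  obtains r' where "(q, p, r') \<in> oriented" "t' = {q, p, r'}"
  using t'(1,2)
proof (cases rule: cell_cases)
  case interior
  then show ?thesis
    using interior_cell_unique[OF t'(1) orientedD(1)[OF o]] edge_subset_cell x t'(3) by blast
next
  case (vertex y)
  then show ?thesis using edge_not_vertex[OF o x, of y] t'(1) by blast
next
  case (edge a b c)
  note o' = edge(1)
  define e where "e = pos q - pos p"
  define f where "f = pos b - pos a"
  have "e \<noteq> 0" "f \<noteq> 0" using orientedD[OF o] orientedD[OF o'] by (auto simp: e_def f_def)
  \<comment> \<open>A common left direction would lead from \<open>x\<close> into both interiors at
    once.\<close>
  have "\<not> (cross2 e u > 0 \<and> cross2 f u > 0)" for u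
  proof
    assume u: "cross2 e u > 0 \<and> cross2 f u > 0"
    have "\<forall>\<^sub>F s in at_right 0. x + s *\<^sub>R u \<in> interior (cell {p, q, r})"
      "\<forall>\<^sub>F s in at_right 0. x + s *\<^sub>R u \<in> interior (cell {a, b, c})"
      using eventually_interior_cell[OF o x, of u] eventually_interior_cell[OF o' edge(3), of u] u
      by (auto simp: e_def f_def)
    then have "\<forall>\<^sub>F s in at_right (0::real). False"
      by eventually_elim (use disjoint[OF orientedD(1)[OF o] t'(1)] t'(3) edge(2) in blast)
    then show False by simp
  qed
  then obtain k where k: "k > 0" and f: "f = - k *\<^sub>R e"
    using no_common_left_side[OF \<open>e \<noteq> 0\<close> _ \<open>f \<noteq> 0\<close>] by metis
  obtain l where l: "0 < l" "l < 1" and xl: "x = (1 - l) *\<^sub>R pos p + l *\<^sub>R pos q"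
    using x unfolding in_segment by blast
  obtain m where m: "0 < m" "m < 1" and xm: "x = (1 - m) *\<^sub>R pos a + m *\<^sub>R pos b"
    using edge(3) unfolding in_segment by blast
  \<comment> \<open>All four endpoints are now measured from \<open>x\<close> along one line, with
    \<open>f\<close> pointing against \<open>e\<close>.\<close>
  have p: "pos p = x - l *\<^sub>R e" and q: "pos q = x + (1 - l) *\<^sub>R e"
    unfolding xl e_def by (simp_all add: algebra_simps)
  have a': "pos a = x - m *\<^sub>R f" and b': "pos b = x + (1 - m) *\<^sub>R f"
    unfolding xm f_def by (simp_all add: algebra_simps)
  have fk: "e = - (1 / k) *\<^sub>R f" using f k by simp
  have ins: "a \<in> \<Union>T" "b \<in> \<Union>T" "p \<in> \<Union>T" "q \<in> \<Union>T"
    using orientedD(1)[OF o] orientedD(1)[OF o'] by blast+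
  have on_pq: "s \<le> 0 \<or> 1 \<le> s" if "y \<in> \<Union>T" "pos y = pos p + s *\<^sub>R e" for y s
    using edge_not_vertex[OF o _ that(1)] mem_open_segment_add[of "pos p" "pos q" s] that(2)
      orientedD(3)[OF o] unfolding e_def by (metis not_le)
  have on_ab: "s \<le> 0 \<or> 1 \<le> s" if "y \<in> \<Union>T" "pos y = pos a + s *\<^sub>R f" for y s
    using edge_not_vertex[OF o' _ that(1)] mem_open_segment_add[of "pos a" "pos b" s] that(2)
      orientedD(3)[OF o'] unfolding f_def by (metis not_le)
  have mk: "0 < m * k" "0 < (1 - m) * k" using m k by auto
  \<comment> \<open>In units of \<open>e\<close>, \<open>a\<close> lies at distance
    \<open>m * k\<close> and \<open>q\<close> at distance \<open>1 - l\<close> on the same side of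
    \<open>x\<close>. Whichever were nearer would be a vertex inside the other side.\<close>
  have "m * k = 1 - l"
  proof -
    have "pos a = pos p + (l + m * k) *\<^sub>R e" unfolding a' p f by (simp add: algebra_simps)
    then have 1: "1 \<le> l + m * k" using on_pq[OF ins(1)] l mk by fastforce
    have "pos q = pos a + (m - (1 - l) / k) *\<^sub>R f"
      unfolding a' q fk by (simp add: algebra_simps diff_divide_distrib)
    then have "m - (1 - l) / k \<le> 0 \<or> 1 \<le> m - (1 - l) / k" using on_ab[OF ins(4)] by blast
    moreover have "(1 - l) / k > 0" using l k by simp
    ultimately have "m \<le> (1 - l) / k" using m by linarith
    then show ?thesis using 1 k by (simp add: field_simps)
  qed
  then have "pos a = pos q" unfolding a' q f by (simp add: mult.commute)
  then have aq: "a = q" using pos_inj ins by blast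
  have "(1 - m) * k = l"
  proof -
    have "pos b = pos p + (l - (1 - m) * k) *\<^sub>R e" unfolding b' p f by (simp add: algebra_simps)
    then have 1: "l \<le> (1 - m) * k" using on_pq[OF ins(2)] l mk by fastforce
    have "pos p = pos a + (m + l / k) *\<^sub>R f"
      unfolding a' p fk by (simp add: algebra_simps)
    then have "m + l / k \<le> 0 \<or> 1 \<le> m + l / k" using on_ab[OF ins(3)] by blast
    moreover have "l / k > 0" using l k by simp
    ultimately have "1 - m \<le> l / k" using m by linarith
    then show ?thesis using 1 k by (simp add: field_simps)
  qed
  then have "pos b = pos p" unfolding b' p f by (simp add: mult.commute)
  then have "b = p" using pos_inj ins by blast
  then show ?thesis using that[of c] aq o' edge(2) by blast
qed

lemma midpoint_in_edge:
  assumes "(p, q, r) \<in> oriented"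
  shows "midpoint (pos p) (pos q) \<in> open_segment (pos p) (pos q)"
  using orientedD(3)[OF assms] by (simp add: midpoint_in_open_segment)

text \<open>By \<open>edge_shared\<close>, a different triangle on the same edge has its apex on the
  opposite side, against the orientation of \<open>r'\<close>.\<close>

lemma apex_unique:
  assumes o: "(p, q, r) \<in> oriented" and o': "(p, q, r') \<in> oriented"
  shows "r = r'"
proof -
  have "{p, q, r} = {p, q, r'}"
  proof (rule ccontr)
    assume ne: "{p, q, r} \<noteq> {p, q, r'}"
    obtain s where s: "(q, p, s) \<in> oriented" "{p, q, r'} = {q, p, s}"
      using edge_shared[OF o midpoint_in_edge[OF o] orientedD(1)[OF o']]
        midpoint_in_edge[OF o] edge_subset_cell ne by blast
    then have "s = r'" using orientedD[OF o'] orientedD[OF s(1)] by auto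
    then show False using orientedD(2)[OF s(1)] orientedD(2)[OF o'] orient_swap[of "pos q" "pos p" "pos r'"]
        by simp
  qed
  then show ?thesis using orientedD[OF o] orientedD[OF o'] by auto
qed

section \<open>Boundary edges, and propagation from triangle to triangle\<close>

lemma supporting_line:
  assumes "x \<in> region" "x \<notin> interior region"
  obtains a where "a \<noteq> 0" "\<And>y. y \<in> region \<Longrightarrow> a \<bullet> y \<le> a \<bullet> x"
proof -
  have conv: "convex region" using convex_region by (simp add: region_def)
  obtain t where t: "t \<in> T" using assms(1) unfolding region_def by blast
  then have "interior (cell t) \<subseteq> interior region"
    unfolding region_def by (intro interior_mono) blast
  then have "rel_interior region = interior region"
    using interior_cell_nonempty[OF t] rel_interior_nonempty_interior by blast
  then have "x \<notin> rel_interior region" using assms(2) by simp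
  moreover have cl: "x \<in> closure region" using assms(1) closure_subset by blast
  ultimately obtain a where a: "a \<noteq> 0" "\<And>y. y \<in> closure region
      \<Longrightarrow> a \<bullet> x \<le> a \<bullet> y"
    using supporting_hyperplane_relative_frontier[OF conv cl] by metis
  have "- a \<bullet> y \<le> - a \<bullet> x" if "y \<in> region" for y
    using a(2)[OF subsetD[OF closure_subset that]] by simp
  then show ?thesis using that[of "- a"] a(1) by simp
qed

lemma vertex_in_region: "p \<in> \<Union>T \<Longrightarrow> pos p \<in> region"
  unfolding region_def by (auto intro: hull_inc)

text \<open>The midpoint of the side decides: if it is interior to the region, some other cell must
  cover the points just beyond the side; otherwise a supporting line exists there.\<close>

lemma neighbour_or_boundary:
  assumes o: "(p, q, r) \<in> oriented"
  obtains (neighbour) r' where "(q, p, r') \<in> oriented"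
  | (boundary) a where "a \<noteq> 0" "\<And>y. y \<in> region
      \<Longrightarrow> a \<bullet> y \<le> a \<bullet> pos p" "\<And>y. y \<in> region
          \<Longrightarrow> a \<bullet> y \<le> a \<bullet> pos q"
proof -
  let ?m = "midpoint (pos p) (pos q)"
  have m: "?m \<in> open_segment (pos p) (pos q)" using midpoint_in_edge[OF o] .
  have mr: "?m \<in> region" using m edge_subset_cell orientedD(1)[OF o] unfolding region_def by blast
  show thesis
  proof (cases "?m \<in> interior region")
    case True
    \<comment> \<open>Right normal of the side: points shifted along \<open>u\<close> leave the
      triangle, so they lie in the closed union of the other cells, and so does their limit.\<close>
    define u where "u = - perp (pos q - pos p)"
    let ?R = "\<Union>t\<in>T - {{p,q,r}}. cell t"
    have cl: "closed ?R"
      using finite_T compact_cell by (intro closed_UN) (auto intro: compact_imp_closed)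
    have lim: "((\<lambda>s. ?m + s *\<^sub>R u) \<longlongrightarrow> ?m + 0 *\<^sub>R u) (at_right 0)"
        by (intro tendsto_intros)
    have "\<forall>\<^sub>F s in at_right 0. ?m + s *\<^sub>R u \<in> interior region"
      using lim True topological_tendstoD by fastforce
    moreover have "\<forall>\<^sub>F s::real in at_right 0. 0 < s" by (simp add: eventually_at_right_less)
    ultimately have "\<forall>\<^sub>F s in at_right 0. ?m + s *\<^sub>R u \<in> ?R"
    proof eventually_elim
      case (elim s)
      have "fst (pos q - pos p) * fst (pos q - pos p) + snd (pos q - pos p) * snd (pos q - pos p) > 0"
        using orientedD(3)[OF o]
            by (metis eq_iff_diff_eq_0 prod_eqI fst_zero snd_zero sum_squares_gt_zero_iff)
      moreover have "orient (pos p) (pos q) (?m + s *\<^sub>R u) = - s *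
        (fst (pos q - pos p) * fst (pos q - pos p) + snd (pos q - pos p) * snd (pos q - pos p))"
        by (simp add: orient_def cross2_def u_def perp_def midpoint_def field_simps)
      ultimately have "orient (pos p) (pos q) (?m + s *\<^sub>R u) < 0"
        using elim(2) by (simp add: mult_neg_pos del: mult_minus_left fst_diff snd_diff)
      then have "?m + s *\<^sub>R u \<notin> cell {p, q, r}" unfolding mem_cell_iff[OF o] by linarith
      then show ?case using elim(1) interior_subset unfolding region_def by blast
    qed
    then have "?m \<in> ?R" using Lim_in_closed_set[OF cl _ _ lim] by simp
    then show ?thesis using edge_shared[OF o m] neighbour by blast
  next
    case False
    then obtain a where a: "a \<noteq> 0" "\<And>y. y \<in> region
        \<Longrightarrow> a \<bullet> y \<le> a \<bullet> ?m"
      using supporting_line mr by blast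
    \<comment> \<open>A linear functional that attains its maximum at a midpoint attains it at both
      ends.\<close>
    have "a \<bullet> pos p \<le> a \<bullet> ?m" "a \<bullet> pos q \<le> a \<bullet> ?m"
      using a(2) vertex_in_region orientedD(1)[OF o] by blast+
    moreover have "a \<bullet> ?m = (a \<bullet> pos p + a \<bullet> pos q) / 2"
      by (simp add: midpoint_def inner_add_right)
    ultimately show ?thesis using boundary[OF a(1)] a(2) by force
  qed
qed

text \<open>A convex set that is not collinear stays connected when the finitely many vertices are
  removed. The cells with value \<open>f t\<close> and the remaining ones form two closed sets
  covering it, which could only meet on an edge, where \<open>f\<close> agrees. Only edges that meet
  \<open>S\<close> are constrained, so that \<open>S\<close> may be a small half disc.\<close>

lemma constant_on_cells:
  assumes S: "convex S" "\<not> collinear S" "S \<subseteq> region"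
    and eq: "\<And>p q r r' x. \<lbrakk>(p, q, r) \<in> oriented; (q, p, r') \<in> oriented; x \<in> S;
       x \<in> open_segment (pos p) (pos q)\<rbrakk> \<Longrightarrow> f {p, q, r} = f {q, p, r'}"
    and t: "t \<in> T" "x \<in> cell t" "x \<in> S" "x \<notin> pos ` \<Union>T"
    and t': "t' \<in> T" "x' \<in> cell t'" "x' \<in> S" "x' \<notin> pos ` \<Union>T"
  shows "f t = f t'"
proof (rule ccontr)
  assume ne: "f t \<noteq> f t'"
  define A where "A = (\<Union>s\<in>{s\<in>T. f s = f t}. cell s)"
  define B where "B = (\<Union>s\<in>{s\<in>T. f s \<noteq> f t}. cell s)"
  have "closed A" "closed B"
    unfolding A_def B_def using finite_T compact_cell
    by (intro closed_UN; auto intro: compact_imp_closed)+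
  moreover have "connected (S - pos ` \<Union>T)"
    using connected_convex_diff_countable[OF S(1,2)] finite_vertices
    by (metis countable_finite finite_imageI)
  moreover have "S - pos ` \<Union>T \<subseteq> A \<union> B"
  proof
    fix y assume "y \<in> S - pos ` \<Union>T"
    then have "y \<in> region" using S(3) by (meson DiffD1 subsetD)
    then obtain s where "s \<in> T" "y \<in> cell s" unfolding region_def by (rule UN_E)
    then show "y \<in> A \<union> B" unfolding A_def B_def by (cases "f s = f t") auto
  qed
  moreover have "A \<inter> B \<inter> (S - pos ` \<Union>T) = {}"
  proof -
    have "f s = f s'" if s: "s \<in> T" "y \<in> cell s" and s': "s' \<in> T" "y \<in> cell s'"
      and y: "y \<in> S" "y \<notin> pos ` \<Union>T" for s s' y
    proof (cases "s = s'")
      case False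
      from s show ?thesis
      proof (cases rule: cell_cases)
        case interior then show ?thesis using interior_cell_unique s s' False by blast
      next
        case (vertex p) then show ?thesis using y s(1) by blast
      next
        case (edge p q r)
        obtain r' where "(q, p, r') \<in> oriented" "s' = {q, p, r'}"
          using edge_shared[OF edge(1,3) s'] False edge(2) by metis
        then show ?thesis using eq[OF edge(1) _ y(1) edge(3)] edge(2) by blast
      qed
    qed simp
    then have "\<not> (y \<in> A \<and> y \<in> B)" if "y \<in> S" "y \<notin> pos ` \<Union>T" for y
      using that unfolding A_def B_def by (smt (verit) UN_iff mem_Collect_eq)
    then show ?thesis by (intro equals0I) (metis DiffE IntE)
  qed
  moreover have "x \<in> A" "x' \<in> B"
    using t(1,2) t'(1,2) ne unfolding A_def B_def by auto
  then have "x \<in> A \<inter> (S - pos ` \<Union>T)" "x' \<in> B \<inter> (S - pos ` \<Union>T)"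
      using t(3,4) t'(3,4) by simp_all
  then have "A \<inter> (S - pos ` \<Union>T) \<noteq> {}" "B \<inter> (S - pos ` \<Union>T) \<noteq> {}"
      by (metis emptyE)+
  ultimately show False using connected_closedD[of "S - pos ` \<Union>T" A B] by argo
qed

section \<open>Infinitesimal rigidity of a planar triangulation\<close>

lemma triangle_rigid:
  assumes o: "(p, q, r) \<in> oriented"
    and flex: "\<And>x y. x \<in> {p, q, r} \<Longrightarrow> y \<in> {p, q, r}
        \<Longrightarrow> (w x - w y) \<bullet> (pos x - pos y) = 0"
  shows "\<exists>kb. \<forall>x\<in>{p, q, r}. w x = snd kb + fst kb *\<^sub>R perp (pos x)"
proof -
  let ?e = "pos q - pos p" and ?f = "pos r - pos p"
  obtain k where k: "w q - w p = k *\<^sub>R perp ?e"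
    using orthogonal_imp_perp[of "w q - w p" ?e] flex[of q p] orientedD[OF o] by auto
  obtain l where l: "w r - w p = l *\<^sub>R perp ?f"
    using orthogonal_imp_perp[of "w r - w p" ?f] flex[of r p] orientedD[OF o] by auto
  \<comment> \<open>The sides at \<open>p\<close> give angular speeds \<open>k\<close> and
    \<open>l\<close>; the third side forces them to be equal because the triangle is not
    degenerate.\<close>
  have "(w q - w r) \<bullet> (pos q - pos r) = 0" using flex by simp
  moreover have "w q - w r = k *\<^sub>R perp ?e - l *\<^sub>R perp ?f" using k l by (simp add: algebra_simps)
  moreover have "pos q - pos r = ?e - ?f" by simp
  moreover have "(k *\<^sub>R perp ?e - l *\<^sub>R perp ?f) \<bullet> (?e - ?f) = (l - k) * orient (pos p) (pos q) (pos r)"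
    by (simp add: orient_def cross2_def perp_def inner_prod_def algebra_simps)
  ultimately have "(l - k) * orient (pos p) (pos q) (pos r) = 0" by metis
  then have "l = k" using orientedD(2)[OF o] by simp
  then have "w q = w p + k *\<^sub>R (perp (pos q) - perp (pos p))" "w r = w p + k *\<^sub>R (perp (pos r) - perp (pos p))"
    using k l by (auto simp: perp_diff algebra_simps)
  \<comment> \<open>The motion is stored as a pair of angular speed and translation, so that
    \<open>constant_on_cells\<close> can treat it as one value.\<close>
  then show ?thesis
    by (intro exI[of _ "(k, w p - k *\<^sub>R perp (pos p))"]) (auto simp: algebra_simps)
qed

lemma not_collinear_region:
  assumes "t \<in> T" shows "\<not> collinear region"
proof -
  obtain p q r where o: "(p, q, r) \<in> oriented" "t = {p, q, r}" using obtain_oriented assms by metis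
  then have "{pos p, pos q, pos r} \<subseteq> region" using vertex_in_region assms by blast
  then show ?thesis
    using orient_nonzero_not_collinear[of "pos p" "pos q" "pos r"] orientedD(2)[OF o(1)] collinear_subset
        by force
qed

text \<open>Each triangle moves rigidly, and a planar motion is determined by its values at two
  distinct points; hence triangles sharing an edge have the same motion, and
  \<open>constant_on_cells\<close> carries it over the whole region.\<close>

lemma flex_rigid:
  assumes flex: "\<And>t x y. t \<in> T \<Longrightarrow> x \<in> t \<Longrightarrow> y \<in> t
      \<Longrightarrow> (w x - w y) \<bullet> (pos x - pos y) = 0"
  shows "\<exists>k b. \<forall>p\<in>\<Union>T. w p = b + k *\<^sub>R perp (pos p)"
proof (cases "T = {}")
  case True
  then show ?thesis by simp
next
  case False
  then obtain t0 where t0: "t0 \<in> T" by blast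
  have "\<exists>kb. \<forall>x\<in>t. w x = snd kb + fst kb *\<^sub>R perp (pos x)" if t: "t \<in> T" for t
  proof -
    obtain p q r where o: "(p, q, r) \<in> oriented" "t = {p, q, r}" using obtain_oriented t by metis
    then show ?thesis using triangle_rigid[OF o(1)] flex t by blast
  qed
  then obtain kb where kb: "\<And>t x. t \<in> T \<Longrightarrow> x \<in> t
      \<Longrightarrow> w x = snd (kb t) + fst (kb t) *\<^sub>R perp (pos x)"
    by metis
  have "kb t = kb t0" if t: "t \<in> T" for t
  proof -
    \<comment> \<open>The midpoint of a side serves as a point of the cell that is not a
      vertex.\<close>
    have ex: "\<exists>x. x \<in> cell s \<and> x \<in> region
        \<and> x \<notin> pos ` \<Union>T" if s: "s \<in> T" for s
    proof -
      obtain p q r where o: "(p, q, r) \<in> oriented" "s = {p, q, r}" using obtain_oriented s by metis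
      let ?m = "midpoint (pos p) (pos q)"
      have m: "?m \<in> cell s" using midpoint_in_edge[OF o(1)] edge_subset_cell o(2) by blast
      then have "?m \<in> region" using s unfolding region_def by (rule UN_I[rotated])
      moreover have "?m \<notin> pos ` \<Union>T"
        using edge_not_vertex[OF o(1) midpoint_in_edge[OF o(1)]] by (metis imageE)
      ultimately show ?thesis using m by (intro exI[of _ ?m]) simp
    qed
    have eq: "kb {p, q, r} = kb {q, p, r'}"
      if o: "(p, q, r) \<in> oriented" and o': "(q, p, r') \<in> oriented" for p q r r'
    proof -
      let ?a = "kb {p, q, r}" and ?b = "kb {q, p, r'}"
      have 1: "w p = snd ?a + fst ?a *\<^sub>R perp (pos p)" "w p = snd ?b + fst ?b *\<^sub>R perp (pos p)"
        "w q = snd ?a + fst ?a *\<^sub>R perp (pos q)" "w q = snd ?b + fst ?b *\<^sub>R perp (pos q)"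
        using kb orientedD(1)[OF o] orientedD(1)[OF o'] by blast+
      \<comment> \<open>Taking differences along the shared edge removes the translations and
        compares the angular speeds alone.\<close>
      have "(fst ?a - fst ?b) *\<^sub>R perp (pos q - pos p) = 
        ((snd ?a + fst ?a *\<^sub>R perp (pos q)) - (snd ?a + fst ?a *\<^sub>R perp (pos p))) - 
        ((snd ?b + fst ?b *\<^sub>R perp (pos q)) - (snd ?b + fst ?b *\<^sub>R perp (pos p)))"
        unfolding perp_diff by (simp add: algebra_simps)
      also have "\<dots> = 0" using 1 by simp
      finally have "fst ?a = fst ?b"
        using orientedD(3)[OF o] by (auto simp: perp_def prod_eq_iff)
      then show ?thesis using 1 by (simp add: prod_eq_iff)
    qed
    obtain x where x: "x \<in> cell t" "x \<in> region" "x \<notin> pos ` \<Union>T" using ex[OF t] by blast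
    obtain y where y: "y \<in> cell t0" "y \<in> region" "y \<notin> pos ` \<Union>T" using ex[OF t0] by blast
    have "convex region" using convex_region by (simp add: region_def)
    then show ?thesis
      using constant_on_cells[of region kb, OF _ not_collinear_region[OF t0] _ eq t x t0 y] by blast
  qed
  then show ?thesis using kb by (metis UnionE)
qed

end

section \<open>Flexes of concave piecewise linear surfaces\<close>

text \<open>The two contributions \<open>X\<close> of an interior edge \<open>e\<close>, with height jump \<open>z\<close> along it.\<close>

lemma edge_energy:
  assumes g: "g - g' = s *\<^sub>R perp e" and c: "c - c' = s' *\<^sub>R perp e"
    and z: "z = c' \<bullet> e" and w: "w \<bullet> e + z * (g' \<bullet> e) = 0"
  shows "(cross2 g c * z - cross2 c w) + (cross2 g' c' * (- z) - cross2 c' (- w)) = - s * z\<^sup>2"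
proof -
  have g: "g = g' + s *\<^sub>R perp e" and c: "c = c' + s' *\<^sub>R perp e"
    using g c by (simp_all add: algebra_simps)
  \<comment> \<open>The coefficient of \<open>s'\<close> is exactly the flex equation of the edge,
    so the unknown jump of \<open>c\<close> drops out.\<close>
  have "(cross2 g c * z - cross2 c w) + (cross2 g' c' * (- z) - cross2 c' (- w))
     = - s * (c' \<bullet> e) * z + s' * (w \<bullet> e + z * (g' \<bullet> e))"
    unfolding g c by (simp add: cross2_def perp_def inner_prod_def algebra_simps)
  also have "\<dots> = - s * z\<^sup>2" using w by (simp add: z[symmetric] power2_eq_square)
  finally show ?thesis .
qed

text \<open>\<open>below\<close> is concavity: the plane of each triangle lies above all vertices.
  \<open>strict\<close> says that each vertex is genuine: triangles at \<open>p\<close> with equal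
  gradient contain no two distinct points opposite to each other about \<open>p\<close>.\<close>

locale concave_surface = triangulated_region pos T
  for pos :: "'a \<Rightarrow> real \<times> real" and T +
  fixes H :: "'a \<Rightarrow> real" and G :: "'a set \<Rightarrow> real \<times> real"
  assumes below: "\<lbrakk>t \<in> T; p \<in> t; q \<in> \<Union>T\<rbrakk>
      \<Longrightarrow> H q \<le> H p + G t \<bullet> (pos q - pos p)"
    and strict: "\<lbrakk>t \<in> T; t' \<in> T; p \<in> t; p \<in> t'; G t = G t'; x \<in> convex hull (pos ` t);
      x' \<in> convex hull (pos ` t'); pos p = midpoint x x'\<rbrakk> \<Longrightarrow> x = x'"
begin

text \<open>Follows from \<open>below\<close> applied in both directions.\<close>

lemma H_affine:
  assumes "t \<in> T" "p \<in> t" "q \<in> t"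
  shows "H q - H p = G t \<bullet> (pos q - pos p)"
  using below[OF assms(1), of p q] below[OF assms(1), of q p] assms
  by (force simp: inner_diff_right)

text \<open>The weight depends on the triangle only, so rotating the labels turns the sum over
  \<open>f q\<close> into the sum over \<open>f p\<close>.\<close>

lemma sum_cyclic:
  fixes K :: "'a set \<Rightarrow> real" and f :: "'a \<Rightarrow> real"
  shows "(\<Sum>(p, q, r)\<in>oriented. K {p, q, r} * (f q - f p)) = 0"
proof -
  have "bij_betw (\<lambda>(p, q, r). (q, r, p)) oriented oriented"
    by (rule bij_betw_byWitness[where f' = "\<lambda>(p, q, r). (r, p, q)"])
      (auto intro: oriented_cycle)
  then have "(\<Sum>(p, q, r)\<in>oriented. K {p, q, r} * f p) =
     (\<Sum>x\<in>oriented. (\<lambda>(p, q, r). K {p, q, r} * f p) ((\<lambda>(p, q, r). (q, r, p)) x))"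
    by (rule sum.reindex_bij_betw[symmetric])
  also have "\<dots> = (\<Sum>(p, q, r)\<in>oriented. K {p, q, r} * f q)"
    by (rule sum.cong) (auto simp: insert_commute)
  finally show ?thesis
    by (simp add: right_diff_distrib sum_subtractf case_prod_unfold)
qed

lemma gradient_exists:
  fixes f :: "'a \<Rightarrow> real"
  assumes "t \<in> T"
  shows "\<exists>c. \<forall>p\<in>t. \<forall>q\<in>t. f q - f p = c \<bullet> (pos q - pos p)"
proof -
  obtain p q r where o: "(p, q, r) \<in> oriented" and t: "t = {p, q, r}" using obtain_oriented assms by metis
  let ?D = "orient (pos p) (pos q) (pos r)"
  have D: "?D \<noteq> 0" using orientedD(2)[OF o] by simp
  \<comment> \<open>Cramer's rule for the prescribed increments along the two sides at
    \<open>p\<close>, using that \<open>perp a \<bullet> b\<close> is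
    \<open>cross2 a b\<close>.\<close>
  define c where "c = (1 / ?D) *\<^sub>R ((f r - f p) *\<^sub>R perp (pos q - pos p) - (f q - f p) *\<^sub>R perp (pos r - pos p))"
  have "perp a \<bullet> b = cross2 a b" for a b by (simp add: perp_def cross2_def inner_prod_def)
  then have cc: "c \<bullet> a = (1 / ?D) * ((f r - f p) * cross2 (pos q - pos p) a - (f q - f p) * cross2 (pos r - pos p) a)" for a
    unfolding c_def by (simp add: inner_diff_left)
  have self: "cross2 a a = 0" "cross2 b a = - cross2 a b" for a b by (simp_all add: cross2_def)
  have 1: "c \<bullet> (pos q - pos p) = f q - f p"
    using D by (simp add: cc self(1) self(2)[of "pos r - pos p" "pos q - pos p"] orient_def)
  have 2: "c \<bullet> (pos r - pos p) = f r - f p"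
    unfolding cc self(1) using D by (simp add: orient_def)
  have const: "c \<bullet> pos x - f x = c \<bullet> pos p - f p" if "x \<in> t" for x
    using 1 2 that unfolding t by (auto simp: inner_diff_right)
  have "f y - f x = c \<bullet> (pos y - pos x)" if "x \<in> t" "y \<in> t" for x y
    using const[OF that(1)] const[OF that(2)] unfolding inner_diff_right by linarith
  then show ?thesis by blast
qed

section \<open>Vanishing of the vertical velocities\<close>

context
  fixes w :: "'a \<Rightarrow> real \<times> real" and z :: "'a \<Rightarrow> real"
  assumes flex: "\<And>t p q. \<lbrakk>t \<in> T; p \<in> t; q \<in> t\<rbrakk> \<Longrightarrow>
      (w p - w q) \<bullet> (pos p - pos q) + (z p - z q) * (H p - H q) = 0"
    and boundary_zero: "\<And>p a. \<lbrakk>p \<in> \<Union>T; a \<noteq> 0; \<And>y. y \<in> region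
        \<Longrightarrow> a \<bullet> y \<le> a \<bullet> pos p\<rbrakk> \<Longrightarrow> z p = 0"
begin

text \<open>An energy argument: the edge terms \<open>X\<close> sum to zero, while each pair of
  opposite directed edges contributes a nonnegative multiple of \<open>(z q - z p)\<^sup>2\<close>,
  so every pair contributes zero. The multiple is not zero where the gradient jumps.\<close>

lemma height_constant_on_ridges:
  assumes "(p, q, r) \<in> oriented" "(q, p, r') \<in> oriented" "G {p, q, r} \<noteq> G {q, p, r'}"
  shows "z p = z q"
proof -
  obtain C where C: "\<And>t p q. t \<in> T \<Longrightarrow> p \<in> t \<Longrightarrow> q \<in> t
      \<Longrightarrow> z q - z p = C t \<bullet> (pos q - pos p)"
    using gradient_exists[of _ z] by metis
  define X where "X = (\<lambda>(p, q, r). cross2 (G {p, q, r}) (C {p, q, r}) * (z q - z p) - cross2 (C {p, q, r}) (w q - w p))"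
  have "(\<Sum>y\<in>oriented. X y) = (\<Sum>(p, q, r)\<in>oriented. cross2 (G {p, q, r}) (C {p, q, r}) * (z q - z p))
     - (\<Sum>(p, q, r)\<in>oriented. fst (C {p, q, r}) * (snd (w q) - snd (w p)))
     + (\<Sum>(p, q, r)\<in>oriented. snd (C {p, q, r}) * (fst (w q) - fst (w p)))"
    unfolding sum_subtractf[symmetric] sum.distrib[symmetric] X_def
    by (rule sum.cong) (auto simp: cross2_def)
  also have "\<dots> = 0"
    using sum_cyclic[of "\<lambda>t. cross2 (G t) (C t)" z] sum_cyclic[of "\<lambda>t. fst (C t)" "\<lambda>x. snd (w x)"]
      sum_cyclic[of "\<lambda>t. snd (C t)" "\<lambda>x. fst (w x)"] by simp
  finally have sum0: "(\<Sum>y\<in>oriented. X y) = 0" .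
  \<comment> \<open>\<open>E\<close> holds the directed interior edges, and \<open>\<sigma>\<close>
    passes to the reversed edge in the neighbour, which \<open>apex_unique\<close> makes well
    defined.\<close>
  define E where "E = {(p, q, r)\<in>oriented. \<exists>r'. (q, p, r') \<in> oriented}"
  define \<sigma> where "\<sigma> = (\<lambda>(p, q, r::'a). (q, p, THE r'. (q, p, r') \<in> oriented))"
  have \<sigma>: "\<sigma> (p, q, r) = (q, p, r')" if "(q, p, r') \<in> oriented" for p q r r'
    using the_equality[of "\<lambda>r'. (q, p, r') \<in> oriented", OF that] apex_unique that
    unfolding \<sigma>_def by auto
  have bd: "X (p, q, r) = 0" if o: "(p, q, r) \<in> oriented" and n: "(p, q, r) \<notin> E" for p q r
    using o
  proof (cases rule: neighbour_or_boundary)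
    case (neighbour r') then show ?thesis using o n by (auto simp: E_def)
  next
    case (boundary a)
    \<comment> \<open>With \<open>z\<close> zero at both ends, the gradient of \<open>z\<close> and
      the velocity difference are both normal to the edge, so their cross product vanishes.\<close>
    have t: "{p, q, r} \<in> T" "p \<in> \<Union>T" "q \<in> \<Union>T" using orientedD(1)[OF o] by blast+
    have z0: "z p = 0" "z q = 0"
        using boundary_zero[OF t(2) boundary(1)] boundary_zero[OF t(3) boundary(1)] boundary(2,3) by blast+
    have "C {p, q, r} \<bullet> (pos q - pos p) = 0" using C[OF t(1), of p q] z0 by simp
    moreover have "(w q - w p) \<bullet> (pos q - pos p) = 0" using flex[OF t(1), of q p] z0 by simp
    moreover have "pos q - pos p \<noteq> 0" using orientedD(3)[OF o] by simp
    ultimately obtain k l where kl: "C {p, q, r} = k *\<^sub>R perp (pos q - pos p)" "w q - w p = l *\<^sub>R perp (pos q - pos p)"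
      using orthogonal_imp_perp by metis
    have "cross2 (C {p, q, r}) (w q - w p) = 0" unfolding kl by (simp add: cross2_def)
    then show ?thesis using z0 by (simp add: X_def)
  qed
  have E: "E \<subseteq> oriented" "finite E" using finite_oriented by (auto simp: E_def intro: finite_subset)
  have sumE: "(\<Sum>y\<in>E. X y) = 0"
    using sum.mono_neutral_left[OF finite_oriented E(1), of X] bd sum0 by fastforce
  \<comment> \<open>Reversal is an involution of \<open>E\<close>, so adding to each edge its
    reverse counts the zero sum twice.\<close>
  have "bij_betw \<sigma> E E"
    by (rule bij_betw_byWitness[where f' = \<sigma>]) (auto simp: E_def \<sigma>)
  then have "(\<Sum>y\<in>E. X (\<sigma> y)) = (\<Sum>y\<in>E. X y)" by (rule sum.reindex_bij_betw)
  then have sum2: "(\<Sum>y\<in>E. X y + X (\<sigma> y)) = 0" using sumE by (simp add: sum.distrib)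
  have key: "\<exists>s\<le>0. G {p, q, r} - G {q, p, r'} = s *\<^sub>R perp (pos q - pos p)
      \<and> X (p, q, r) + X (q, p, r') = - s * (z q - z p)\<^sup>2"
    if o: "(p, q, r) \<in> oriented" and o': "(q, p, r') \<in> oriented" for p q r r'
  proof -
    let ?t = "{p, q, r}" and ?t' = "{q, p, r'}" and ?e = "pos q - pos p"
    have t: "?t \<in> T" "?t' \<in> T" using orientedD(1) o o' by blast+
    have e: "?e \<noteq> 0" using orientedD(3)[OF o] by simp
    have "(G ?t - G ?t') \<bullet> ?e = 0"
      using H_affine[OF t(1), of p q] H_affine[OF t(2), of p q] by (simp add: inner_diff_left)
    then obtain s where s: "G ?t - G ?t' = s *\<^sub>R perp ?e" using orthogonal_imp_perp e by blast
    have zt': "z q - z p = C ?t' \<bullet> ?e" using C[OF t(2), of p q] by simp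
    have "(C ?t - C ?t') \<bullet> ?e = 0"
      using C[OF t(1), of p q] zt' by (simp add: inner_diff_left)
    then obtain s' where s': "C ?t - C ?t' = s' *\<^sub>R perp ?e" using orthogonal_imp_perp e by blast
    have "(w q - w p) \<bullet> ?e + (z q - z p) * (G ?t' \<bullet> ?e) = 0"
      using flex[OF t(2), of q p] H_affine[OF t(2), of p q] by simp
    from edge_energy[OF s s' zt' this]
    have en: "X (p, q, r) + X (q, p, r') = - s * (z q - z p)\<^sup>2"
      unfolding X_def by (simp add: insert_commute)
    \<comment> \<open>Concavity at the neighbour's apex, which lies to the right of the edge, fixes
      the sign of the gradient jump.\<close>
    have "H r' \<le> H p + G ?t \<bullet> (pos r' - pos p)" using below[OF t(1), of p r'] t(2) by blast
    moreover have "H r' = H p + G ?t' \<bullet> (pos r' - pos p)" using H_affine[OF t(2), of p r'] by simp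
    ultimately have "0 \<le> (G ?t - G ?t') \<bullet> (pos r' - pos p)" by (simp add: inner_diff_left)
    also have "\<dots> = s * orient (pos p) (pos q) (pos r')"
      unfolding s by (simp add: perp_def inner_prod_def orient_def cross2_def algebra_simps)
    also have "\<dots> = - s * orient (pos q) (pos p) (pos r')" using orient_swap[of "pos p" "pos q"] by simp
    finally have "s \<le> 0" using orientedD(2)[OF o'] by (simp add: mult_le_0_iff)
    then show ?thesis using s en by blast
  qed
  have nonneg: "0 \<le> X y + X (\<sigma> y)" if oE: "y \<in> E" for y
  proof -
    obtain p q r r' where o: "y = (p, q, r)" "(p, q, r) \<in> oriented" "(q, p, r') \<in> oriented"
      using oE unfolding E_def by blast
    obtain s where "s \<le> 0" "X (p, q, r) + X (q, p, r') = - s * (z q - z p)\<^sup>2" using key[OF o(2,3)]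
        by blast
    then show ?thesis using \<sigma>[OF o(3)] o(1) by (simp add: mult_nonpos_nonneg)
  qed
  have "(p, q, r) \<in> E" using assms by (auto simp: E_def)
  then have "X (p, q, r) + X (\<sigma> (p, q, r)) = 0"
    using sum_nonneg_eq_0_iff[OF E(2), of "\<lambda>y. X y + X (\<sigma> y)"] nonneg sum2 by blast
  then have "X (p, q, r) + X (q, p, r') = 0" using \<sigma>[OF assms(2)] by simp
  moreover obtain s where "G {p, q, r} - G {q, p, r'} = s *\<^sub>R perp (pos q - pos p)"
      "X (p, q, r) + X (q, p, r') = - s * (z q - z p)\<^sup>2"
    using key[OF assms(1,2)] by blast
  ultimately show ?thesis using assms(3) by auto
qed

text \<open>Take the rightmost vertex \<open>p\<close> with \<open>z p \<noteq> 0\<close>. A ridge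
  running to the right from \<open>p\<close> would end at a vertex with the same nonzero
  \<open>z\<close>, so the gradient is constant on a right half disc at \<open>p\<close>. The
  vertical diameter then contradicts \<open>strict\<close>.\<close>

lemma height_zero:
  assumes "p0 \<in> \<Union>T"
  shows "z p0 = 0"
proof (rule ccontr)
  assume "z p0 \<noteq> 0"
  define N where "N = {p\<in>\<Union>T. z p \<noteq> 0}"
  have "finite N" unfolding N_def using finite_vertices by (rule finite_subset[rotated]) blast
  have "N \<noteq> {}" using assms \<open>z p0 \<noteq> 0\<close> by (auto simp: N_def)
  then have "Max ((\<lambda>a. fst (pos a)) ` N) \<in> (\<lambda>a. fst (pos a)) ` N"
      using \<open>finite N\<close> by (intro Max_in) auto
  then obtain p where max: "Max ((\<lambda>a. fst (pos a)) ` N) = fst (pos p)" and p: "p \<in> N"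
      by (rule imageE)
  have pmax: "fst (pos a) \<le> fst (pos p)" if "a \<in> N" for a
    unfolding max[symmetric] using \<open>finite N\<close> that by (intro Max_ge) auto
  have pT: "p \<in> \<Union>T" and zp: "z p \<noteq> 0" using p by (auto simp: N_def)
  \<comment> \<open>What the disc has to avoid: cells without \<open>p\<close> and all other
    vertices. Every cell that meets the disc then has \<open>p\<close> as a corner.\<close>
  define R where "R = (\<Union>t\<in>{t\<in>T. p \<notin> t}. cell t) \<union> pos ` (\<Union>T - {p})"
  have "closed R"
    unfolding R_def using finite_T compact_cell finite_vertices
    by (intro closed_Un closed_UN finite_imp_closed) (auto intro: compact_imp_closed)
  moreover have "pos p \<notin> R"
    using vertex pT pos_inj unfolding R_def by blast
  \<comment> \<open>A supporting line at \<open>pos p\<close> would give \<open>z p = 0\<close> by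
    \<open>boundary_zero\<close>.\<close>
  moreover have "pos p \<in> interior region"
    using supporting_line[of "pos p"] vertex_in_region[OF pT] boundary_zero[OF pT] zp by metis
  ultimately have "open (interior region - R)" "pos p \<in> interior region - R" by (auto intro: open_Diff)
  then obtain e where e: "e > 0" "ball (pos p) e \<subseteq> interior region - R"
    using open_contains_ball by blast
  define S where "S = ball (pos p) e \<inter> {x. fst x > fst (pos p)}"
  have S: "S \<subseteq> region" "S \<inter> R = {}" using e(2) interior_subset by (auto simp: S_def)
  have half: "{x::real \<times> real. fst x > fst (pos p)} = {x. (1, 0) \<bullet> x > fst (pos p)}"
    by (auto simp: inner_prod_def)
  have "convex S" unfolding S_def half by (intro convex_Int convex_ball convex_halfspace_gt)
  have "open S" unfolding S_def half by (intro open_Int open_ball open_halfspace_gt)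
  \<comment> \<open>Points of the vertical diameter are limits of points of the half disc, and the
    cells that meet the half disc form a closed set.\<close>
  have approach: "\<exists>t\<in>T. x \<in> cell t
      \<and> cell t \<inter> S \<noteq> {}" if x: "dist (pos p) x < e" "fst x = fst (pos p)" for x
  proof -
    let ?R = "\<Union>t\<in>{t\<in>T. cell t \<inter> S \<noteq> {}}. cell t"
    have cl: "closed ?R"
      using finite_T compact_cell by (intro closed_UN) (auto intro: compact_imp_closed)
    have lim: "((\<lambda>s. x + s *\<^sub>R (1, 0)) \<longlongrightarrow> x + 0 *\<^sub>R (1, 0)) (at_right 0)" by (intro tendsto_intros)
    have "\<forall>\<^sub>F s in at_right 0. x + s *\<^sub>R (1, 0) \<in> ball (pos p) e"
      using topological_tendstoD[OF lim, of "ball (pos p) e"] x by (simp flip: zero_prod_def)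
    moreover have "\<forall>\<^sub>F s::real in at_right 0. 0 < s" by (simp add: eventually_at_right_less)
    ultimately have "\<forall>\<^sub>F s in at_right 0. x + s *\<^sub>R (1, 0) \<in> ?R"
    proof eventually_elim
      case (elim s)
      then have "x + s *\<^sub>R (1, 0) \<in> S" using x(2) by (simp add: S_def)
      then show ?case using S(1) unfolding region_def by blast
    qed
    then have "x + 0 *\<^sub>R (1, 0) \<in> ?R" using Lim_in_closed_set[OF cl _ _ lim] by simp
    then have "x \<in> ?R" by (simp flip: zero_prod_def)
    then show ?thesis by blast
  qed
  have meets: "p \<in> t" if "t \<in> T" "cell t \<inter> S \<noteq> {}" for t
    using S(2) that unfolding R_def by blast
  \<comment> \<open>Two distinct points of the diameter whose midpoint is \<open>pos p\<close>, as
    \<open>strict\<close> requires.\<close>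
  define x1 where "x1 = pos p + (0, e / 2)"
  define x2 where "x2 = pos p - (0, e / 2)"
  have "dist (pos p) x1 < e" "fst x1 = fst (pos p)" "dist (pos p) x2 < e" "fst x2 = fst (pos p)"
    using e(1) by (auto simp: x1_def x2_def dist_norm norm_Pair)
  then obtain t1 t2 where t1: "t1 \<in> T" "x1 \<in> cell t1" "cell t1 \<inter> S \<noteq> {}"
    and t2: "t2 \<in> T" "x2 \<in> cell t2" "cell t2 \<inter> S \<noteq> {}"
    using approach by metis
  obtain y1 y2 where y: "y1 \<in> cell t1" "y1 \<in> S" "y2 \<in> cell t2" "y2 \<in> S" using t1 t2 by blast
  have novert: "y \<notin> pos ` \<Union>T" if "y \<in> S" for y
    using S(2) that by (force simp: R_def S_def)
  have eq: "G {a, b, c} = G {b, a, c'}"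
    if o: "(a, b, c) \<in> oriented" and o': "(b, a, c') \<in> oriented"
      and x: "x \<in> S" "x \<in> open_segment (pos a) (pos b)" for a b c c' x
  proof (rule ccontr)
    assume ne: "G {a, b, c} \<noteq> G {b, a, c'}"
    have "x \<in> cell {a, b, c}" "x \<in> cell {b, a, c'}"
      using x edge_subset_cell edge_subset_cell[of b a c'] by (auto simp: open_segment_commute)
    then have "p \<in> {a, b, c}" "p \<in> {b, a, c'}"
      using meets x(1) orientedD(1)[OF o] orientedD(1)[OF o'] by blast+
    \<comment> \<open>The apexes lie on opposite sides, so the common corner \<open>p\<close> is an
      end of the ridge. Both ends then have nonzero \<open>z\<close>, lie no further right than
      \<open>p\<close>, and the ridge misses \<open>S\<close>.\<close>
    moreover have "c \<noteq> c'"
        using orientedD(2)[OF o] orientedD(2)[OF o'] orient_swap[of "pos b" "pos a" "pos c"] by auto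
    ultimately have "p = a \<or> p = b" by auto
    moreover have "z a = z b" using height_constant_on_ridges[OF o o' ne] .
    ultimately have "z a \<noteq> 0" "z b \<noteq> 0" using zp by auto
    moreover have "a \<in> \<Union>T" "b \<in> \<Union>T" using orientedD(1)[OF o] by blast+
    ultimately have "a \<in> N" "b \<in> N" by (simp_all add: N_def)
    then have ab: "fst (pos a) \<le> fst (pos p)" "fst (pos b) \<le> fst (pos p)" using pmax by blast+
    obtain u where u: "0 < u" "u < 1" and xu: "x = (1 - u) *\<^sub>R pos a + u *\<^sub>R pos b"
      using x(2) unfolding in_segment by blast
    have "fst x = (1 - u) * fst (pos a) + u * fst (pos b)" unfolding xu by simp
    also have "\<dots> \<le> fst (pos p)" using ab u by (intro convex_bound_le) auto
    finally show False using x(1) by (simp add: S_def)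
  qed
  have nc: "\<not> collinear S"
  proof
    assume "collinear S"
    then have "aff_dim S \<le> 1" by (simp add: collinear_aff_dim)
    moreover have "aff_dim S = 2" using aff_dim_open[OF \<open>open S\<close>] y by fastforce
    ultimately show False by simp
  qed
  have "G t1 = G t2"
  proof (rule constant_on_cells[of S G t1 y1 t2 y2])
    fix a b c c' x
    assume "(a, b, c) \<in> oriented" "(b, a, c') \<in> oriented" "x \<in> S" "x \<in> open_segment (pos a) (pos b)"
    then show "G {a, b, c} = G {b, a, c'}" by (rule eq)
  qed (use \<open>convex S\<close> nc S(1) t1(1) t2(1) y novert in auto)
  moreover have "pos p = midpoint x1 x2"
    by (simp add: x1_def x2_def midpoint_def prod_eq_iff)
  ultimately have "x1 = x2"
    using strict[OF t1(1) t2(1), of p x1 x2] meets t1 t2 by blast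
  then show False using e(1) by (simp add: x1_def x2_def prod_eq_iff)
qed

end

end

section \<open>Triangulated facets\<close>

lemma inner_vec3: "(x::real^3) \<bullet> y = x $ 1 * y $ 1 + x $ 2 * y $ 2 + x $ 3 * y $ 3"
  by (simp add: inner_vec_def sum_3)

lemma vec3_eq_iff: "(x::real^3) = y \<longleftrightarrow> x $ 1 = y $ 1 \<and> x $ 2 = y $ 2
    \<and> x $ 3 = y $ 3"
  by (simp add: vec_eq_iff forall_3)

text \<open>An extreme point lies on no segment between two other points of \<open>F\<close>, so the
  three points are not collinear. Segments stay in the convex set \<open>F\<close>, where
  \<open>L\<close> is injective, so the images are not collinear either.\<close>

lemma extreme_triangle_oriented:
  fixes L :: "'a::euclidean_space \<Rightarrow> real \<times> real"
  assumes "t \<subseteq> {v. v extreme_point_of F}" "card t = 3" "convex F" "linear L" "inj_on L F"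
  shows "\<exists>p q r. t = {p, q, r} \<and> orient (L p) (L q) (L r) > 0" and "\<not> collinear t"
proof -
  obtain a b c where abc: "t = {a, b, c}" "a \<noteq> b" "b \<noteq> c" "a \<noteq> c"
    using assms(2) by (metis card_3_iff)
  have ext: "x extreme_point_of F" if "x \<in> t" for x using assms(1) that by blast
  then have F: "x \<in> F" if "x \<in> t" for x using that by (simp add: extreme_point_of_def)
  have no: "x \<notin> closed_segment y z" if "x \<in> t" "y \<in> t" "z \<in> t" "x \<noteq> y" "x \<noteq> z" for x y z
    using ext[OF that(1)] F[OF that(2)] F[OF that(3)] that(4,5)
    unfolding extreme_point_of_def open_segment_def by blast
  show "\<not> collinear t"
    unfolding abc(1) collinear_between_cases between_mem_segment
    using no[of a b c] no[of b c a] no[of c a b] abc by auto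
  have Lno: "L x \<notin> closed_segment (L y) (L z)" if "x \<in> t" "y \<in> t" "z \<in> t" "x \<noteq> y" "x \<noteq> z" for x y z
  proof
    assume "L x \<in> closed_segment (L y) (L z)"
    then obtain u where u: "u \<in> closed_segment y z" "L x = L u"
      unfolding closed_segment_linear_image[OF assms(4)] by blast
    have "closed_segment y z \<subseteq> F" using closed_segment_subset F that assms(3) by blast
    then have "x = u" using inj_onD[OF assms(5) u(2) F[OF that(1)]] u(1) by blast
    then show False using no[OF that] u(1) by blast
  qed
  have "orient (L a) (L b) (L c) \<noteq> 0"
    using orient_zero_between[of "L a" "L b" "L c"] Lno[of a b c] Lno[of b c a] Lno[of c a b] abc by auto
  then consider "orient (L a) (L b) (L c) > 0" | "orient (L b) (L a) (L c) > 0"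
    using orient_swap[of "L a" "L b" "L c"] by linarith
  then show "\<exists>p q r. t = {p, q, r} \<and> orient (L p) (L q) (L r) > 0"
    using abc(1) by cases (blast, metis insert_commute)
qed

lemma diag_triangulationD:
  assumes "diag_triangulation C tri" "F \<in> nonbase_faces C"
  shows "t \<in> tri F \<Longrightarrow> t \<subseteq> {v. v extreme_point_of F}" "t \<in> tri F
      \<Longrightarrow> card t = 3"
    "(\<Union>t\<in>tri F. convex hull t) = F"
    "\<lbrakk>t \<in> tri F; t' \<in> tri F; t \<noteq> t'\<rbrakk>
        \<Longrightarrow> rel_interior (convex hull t) \<inter> rel_interior (convex hull t') = {}"
proof -
  note D = bspec[OF assms(1)[unfolded diag_triangulation_def] assms(2)]
  show "t \<in> tri F \<Longrightarrow> t \<subseteq> {v. v extreme_point_of F}" "t \<in> tri F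
      \<Longrightarrow> card t = 3"
    using D by simp_all
  show "(\<Union>t\<in>tri F. convex hull t) = F" using D by (elim conjE)
  show "rel_interior (convex hull t) \<inter> rel_interior (convex hull t') = {}"
    if "t \<in> tri F" "t' \<in> tri F" "t \<noteq> t'"
    using D that by simp
qed

text \<open>A nondegenerate triangle spans the same affine plane as the face, and for equal affine
  hulls the relative interior is monotone.\<close>

lemma rel_interior_triangle_subset_face:
  fixes F :: "(real^3) set"
  assumes "t \<subseteq> F" "\<not> collinear t" "convex F" "aff_dim F = 2"
  shows "rel_interior (convex hull t) \<subseteq> rel_interior F"
proof (rule subset_rel_interior)
  show sub: "convex hull t \<subseteq> F" using assms by (simp add: hull_minimal)
  have "aff_dim t \<le> 2" using aff_dim_subset[OF assms(1)] assms(4) by simp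
  moreover have "aff_dim t > 1" using assms(2) by (simp add: collinear_aff_dim)
  ultimately have "aff_dim (convex hull t) = aff_dim F" using assms(4) by (simp add: aff_dim_convex_hull)
  then show "affine hull (convex hull t) = affine hull F"
    using aff_dim_eq_full_gen[OF sub] by blast
qed

lemma interior_linear_image_triangle:
  fixes L :: "real^3 \<Rightarrow> real \<times> real"
  assumes "linear L" "t = {p, q, r}" "orient (L p) (L q) (L r) > 0"
  shows "interior (convex hull (L ` t)) = L ` rel_interior (convex hull t)"
proof -
  have "interior (convex hull (L ` t)) \<noteq> {}"
    using interior_triangle_nonempty[OF assms(3)] assms(2) by simp
  then have "interior (convex hull (L ` t)) = rel_interior (convex hull (L ` t))"
    using rel_interior_nonempty_interior by blast
  also have "\<dots> = rel_interior (L ` (convex hull t))"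
    by (simp add: convex_hull_linear_image[OF assms(1)])
  finally show ?thesis
    by (simp add: rel_interior_convex_linear_image[OF assms(1) convex_convex_hull])
qed

text \<open>Stated for an arbitrary family of facets because it is applied both to the upper facets
  under \<open>shadow\<close> and to a single vertical facet in its own plane coordinates.\<close>

lemma triangulated_region_of_facets:
  fixes L :: "real^3 \<Rightarrow> real \<times> real"
  assumes C: "polytope C" and tri: "diag_triangulation C tri" and Fs: "Fs \<subseteq> nonbase_faces C"
    and L: "linear L" "inj_on L (\<Union>Fs)" and conv: "convex (L ` \<Union>Fs)"
  shows "triangulated_region L (\<Union>F\<in>Fs. tri F)"
    and "(\<Union>t\<in>(\<Union>F\<in>Fs. tri F). convex hull (L ` t)) = L ` \<Union>Fs"
    and "\<Union>(\<Union>F\<in>Fs. tri F) = {v \<in> \<Union>Fs. v extreme_point_of C}"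
proof -
  have face: "F face_of C" "aff_dim F = 2" if "F \<in> Fs" for F
    using that Fs by (auto simp: nonbase_faces_def)
  have FC: "F \<subseteq> C" "convex F" if "F \<in> Fs" for F
    using face[OF that] by (auto simp: face_of_imp_subset face_of_imp_convex)
  note triD = diag_triangulationD[OF tri subsetD[OF Fs]]
  have ext: "p extreme_point_of C" "p \<in> F" if "F \<in> Fs" "t \<in> tri F" "p \<in> t" for F t p
    using triD(1)[OF that(1,2)] that(3) extreme_point_of_face[OF face(1)[OF that(1)]] by blast+
  have hull: "convex hull t \<subseteq> F" if "F \<in> Fs" "t \<in> tri F" for F t
    using triD(3)[OF that(1)] that(2) by blast
  have hullL: "convex hull (L ` t) = L ` (convex hull t)" for t
    by (simp add: convex_hull_linear_image[OF L(1)])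
  have inj: "inj_on L F" if "F \<in> Fs" for F using L(2) that by (meson Sup_upper inj_on_subset)
  \<comment> \<open>An extreme point of \<open>C\<close> remains extreme in a smaller hull, and the
    extreme points of a hull are among its generators.\<close>
  have vert: "p \<in> t" if "p extreme_point_of C" "p \<in> convex hull t" "F \<in> Fs" "t \<in> tri F" for p t F
  proof -
    have "convex hull t \<subseteq> C" using hull[OF that(3,4)] FC(1)[OF that(3)] by blast
    then have "p extreme_point_of (convex hull t)"
      using that(1,2) unfolding extreme_point_of_def by blast
    then show ?thesis by (rule extreme_point_of_convex_hull)
  qed
  show cover: "(\<Union>t\<in>(\<Union>F\<in>Fs. tri F). convex hull (L ` t)) = L ` \<Union>Fs"
  proof -
    have "(\<Union>t\<in>(\<Union>F\<in>Fs. tri F). convex hull (L ` t)) = (\<Union>F\<in>Fs. L ` (\<Union>t\<in>tri F. convex hull t))"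
      unfolding hullL by blast
    also have "\<dots> = (\<Union>F\<in>Fs. L ` F)" using triD(3) by simp
    finally show ?thesis by (simp only: image_Union)
  qed
  show "\<Union>(\<Union>F\<in>Fs. tri F) = {v \<in> \<Union>Fs. v extreme_point_of C}"
  proof
    show "\<Union>(\<Union>F\<in>Fs. tri F) \<subseteq> {v \<in> \<Union>Fs. v extreme_point_of C}"
    proof
      fix v assume "v \<in> \<Union>(\<Union>F\<in>Fs. tri F)"
      then obtain F t where "F \<in> Fs" "t \<in> tri F" "v \<in> t" by blast
      then show "v \<in> {v \<in> \<Union>Fs. v extreme_point_of C}" using ext[of F t v] by auto
    qed
    show "{v \<in> \<Union>Fs. v extreme_point_of C} \<subseteq> \<Union>(\<Union>F\<in>Fs. tri F)"
    proof
      fix v assume "v \<in> {v \<in> \<Union>Fs. v extreme_point_of C}"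
      then obtain F where F: "F \<in> Fs" "v \<in> F" "v extreme_point_of C" by blast
      then obtain t where "t \<in> tri F" "v \<in> convex hull t" using triD(3)[OF F(1)] by blast
      then show "v \<in> \<Union>(\<Union>F\<in>Fs. tri F)" using vert[OF F(3)] F(1) by blast
    qed
  qed
  show "triangulated_region L (\<Union>F\<in>Fs. tri F)"
  proof
    have "finite Fs"
      using finite_subset[OF _ finite_polytope_faces[OF C]] face by blast
    moreover have "finite (tri F)" if "F \<in> Fs" for F
    proof (rule finite_subset)
      show "tri F \<subseteq> Pow {v. v extreme_point_of F}" using triD(1)[OF that] by blast
      show "finite (Pow {v. v extreme_point_of F})"
        using finite_polyhedron_extreme_points polytope_imp_polyhedron
          face_of_polytope_polytope[OF C face(1)[OF that]] by blast
    qed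
    ultimately show "finite (\<Union>F\<in>Fs. tri F)" by blast
  next
    fix t assume "t \<in> (\<Union>F\<in>Fs. tri F)"
    then obtain F where F: "F \<in> Fs" "t \<in> tri F" by blast
    then show "\<exists>p q r. t = {p, q, r} \<and> orient (L p) (L q) (L r) > 0"
      using extreme_triangle_oriented(1)[OF triD(1,2) FC(2) L(1) inj] by blast
  next
    fix t t' assume t: "t \<in> (\<Union>F\<in>Fs. tri F)" "t' \<in> (\<Union>F\<in>Fs. tri F)" "t \<noteq> t'"
    obtain F where F: "F \<in> Fs" "t \<in> tri F" using t(1) by blast
    obtain F' where F': "F' \<in> Fs" "t' \<in> tri F'" using t(2) by blast
    have int: "interior (convex hull (L ` s)) = L ` rel_interior (convex hull s)"
      and sub: "rel_interior (convex hull s) \<subseteq> rel_interior E" if "E \<in> Fs" "s \<in> tri E" for s E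
    proof -
      note o = extreme_triangle_oriented[OF triD(1,2)[OF that(1) that(2)] FC(2)[OF that(1)] L(1) inj[OF that(1)]]
      show "interior (convex hull (L ` s)) = L ` rel_interior (convex hull s)"
        using o(1) interior_linear_image_triangle[OF L(1)] by blast
      show "rel_interior (convex hull s) \<subseteq> rel_interior E"
        using rel_interior_triangle_subset_face[OF _ o(2) FC(2) face(2)] ext(2) that by blast
    qed
    have "rel_interior (convex hull t) \<inter> rel_interior (convex hull t') = {}"
    proof (cases "F = F'")
      case True then show ?thesis using triD(4)[OF F(1)] F F' t(3) by blast
    next
      case False
      \<comment> \<open>Distinct faces of a convex set have disjoint relative interiors.\<close>
      then have "rel_interior F \<inter> rel_interior F' = {}"
        using face_of_eq face(1) F(1) F'(1) by metis
      then show ?thesis using sub[OF F] sub[OF F'] by blast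
    qed
    moreover have "rel_interior (convex hull t) \<subseteq> \<Union>Fs" "rel_interior (convex hull t') \<subseteq> \<Union>Fs"
      using hull[OF F] hull[OF F'] F(1) F'(1) rel_interior_subset by blast+
    ultimately show "interior (convex hull (L ` t)) \<inter> interior (convex hull (L ` t')) = {}"
      unfolding int[OF F] int[OF F'] using inj_on_image_Int[OF L(2)] by (metis image_empty)
  next
    fix t t' p assume t: "t \<in> (\<Union>F\<in>Fs. tri F)" "t' \<in> (\<Union>F\<in>Fs. tri F)" "p \<in> t'" "L p \<in> convex hull (L ` t)"
    obtain F where F: "F \<in> Fs" "t \<in> tri F" using t(1) by blast
    obtain F' where F': "F' \<in> Fs" "t' \<in> tri F'" using t(2) by blast
    obtain y where y: "y \<in> convex hull t" "L p = L y" using t(4) hullL by blast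
    have "p \<in> \<Union>Fs" "y \<in> \<Union>Fs" using ext(2)[OF F' t(3)] hull[OF F] y(1) F(1) F'(1)
        by blast+
    then have "p = y" using L(2) y(2) by (metis inj_onD)
    then show "p \<in> t" using vert ext(1)[OF F' t(3)] y(1) F by blast
  next
    show "convex (\<Union>t\<in>(\<Union>F\<in>Fs. tri F). convex hull (L ` t))" unfolding cover
        by (rule conv)
  qed
qed

section \<open>Facets of a cap\<close>

text \<open>The vertical projection with values in \<open>real \<times> real\<close>, where the
  planar lemmas apply; \<open>vproj\<close> stays in space.\<close>

definition shadow :: "real^3 \<Rightarrow> real \<times> real" where
  "shadow x = (x $ 1, x $ 2)"

lemma linear_shadow: "linear shadow"
  by (rule linearI) (simp_all add: shadow_def)

lemma vproj_nth [simp]: "vproj x $ 1 = x $ 1" "vproj x $ 2 = x $ 2" "vproj x $ 3 = 0"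
  by (simp_all add: vproj_def)

lemma shadow_vproj: "shadow (vproj x) = shadow x"
  by (simp add: shadow_def)

lemma collinear_fibre: "collinear {x::real^3. shadow x = a}"
proof -
  have "\<exists>c. x - y = c *\<^sub>R axis 3 1" if "shadow x = a" "shadow y = a" for x y :: "real^3"
    using that by (intro exI[of _ "x $ 3 - y $ 3"]) (auto simp: vec3_eq_iff shadow_def axis_def)
  then show ?thesis unfolding collinear_def by blast
qed

locale cap3 =
  fixes C :: "(real^3) set"
  assumes cap: "convex_cap C" and dim3: "aff_dim C = 3"
begin

lemma poly: "polytope C" using cap by (simp add: convex_cap_def)
lemma polyhedron_C: "polyhedron C" using poly by (rule polytope_imp_polyhedron)
lemma convex_C: "convex C" using poly by (rule polytope_imp_convex)
lemma compact_C: "compact C" using poly by (rule polytope_imp_compact)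

lemma nonneg: "x \<in> C \<Longrightarrow> 0 \<le> x $ 3" using cap by (auto simp: convex_cap_def)

lemma vproj_in: "x \<in> C \<Longrightarrow> vproj x \<in> C"
  using cap by (auto simp: convex_cap_def cap_base_def)

lemma affine_hull_C: "affine hull C = UNIV"
  using aff_dim_eq_full[of C] dim3 by simp

lemma rel_interior_C: "rel_interior C = interior C"
  by (rule rel_interior_interior[OF affine_hull_C])

lemma interior_nonempty: "interior C \<noteq> {}"
  using rel_interior_C rel_interior_eq_empty[OF convex_C] dim3
      by (metis aff_dim_empty neg_equal_iff_equal numeral_neq_neg_one one_neq_neg_numeral)

lemma not_in_hyperplane:
  assumes "n \<noteq> 0" shows "\<not> C \<subseteq> {x. n \<bullet> x = c}"
  using interior_mono[of C "{x. n \<bullet> x = c}"] interior_hyperplane[OF assms] interior_nonempty by blast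

lemma interior_below:
  assumes "n \<noteq> 0" "C \<subseteq> {x. n \<bullet> x \<le> c}" "i \<in> interior C"
  shows "n \<bullet> i < c"
  using interior_mono[OF assms(2)] interior_halfspace_le[OF assms(1)] assms(3) by blast

lemma not_subset_fibre: "\<not> C \<subseteq> {x. shadow x = a}"
proof
  assume "C \<subseteq> {x. shadow x = a}"
  then have "collinear C" by (rule collinear_subset[OF collinear_fibre])
  then show False using dim3 by (simp add: collinear_aff_dim)
qed

lemma nonbase_iff: "F \<in> nonbase_faces C \<longleftrightarrow> F facet_of C \<and> F \<noteq> cap_base C"
  using dim3 by (auto simp: nonbase_faces_def facet_of_def)

lemma base_face: "cap_base C face_of C"
proof -
  have "cap_base C = C \<inter> {x. axis 3 1 \<bullet> x = 0}"
    by (auto simp: cap_base_def inner_axis')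
  then show ?thesis
    using face_of_Int_supporting_hyperplane_ge[OF convex_C, of 0 "axis 3 1"] nonneg by (simp add: inner_axis')
qed

text \<open>A facet with a downward outer normal would lie in the base plane and so coincide with
  the base by dimension.\<close>

lemma facet_normal:
  assumes F: "F \<in> nonbase_faces C"
  obtains n c where "norm n = 1" "C \<subseteq> {x. n \<bullet> x \<le> c}" "F = C \<inter> {x. n \<bullet> x = c}" "n $ 3 \<ge> 0"
proof -
  have face: "F face_of C" "aff_dim F = 2" "F \<noteq> cap_base C" using F by (auto simp: nonbase_faces_def)
  then have "F exposed_face_of C" using exposed_face_of_polyhedron[OF polyhedron_C] by blast
  then obtain a b where a: "C \<subseteq> {x. a \<bullet> x \<le> b}"
      and Fa: "F = C \<inter> {x. a \<bullet> x = b}"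
    unfolding exposed_face_of_def by blast
  have "a \<noteq> 0"
  proof
    assume "a = 0"
    then have "F = C \<or> F = {}" using Fa by auto
    then show False using face(2) dim3 by auto
  qed
  define n where "n = (1 / norm a) *\<^sub>R a"
  define c where "c = b / norm a"
  have le: "a \<bullet> x \<le> b \<longleftrightarrow> n \<bullet> x \<le> c" and eq: "a \<bullet> x = b
      \<longleftrightarrow> n \<bullet> x = c" for x
    using \<open>a \<noteq> 0\<close> by (simp_all add: n_def c_def field_simps)
  have n: "norm n = 1" using \<open>a \<noteq> 0\<close> by (simp add: n_def)
  have C: "C \<subseteq> {x. n \<bullet> x \<le> c}" using a le by simp
  have Fn: "F = C \<inter> {x. n \<bullet> x = c}" using Fa eq by simp
  have "n $ 3 \<ge> 0"
  proof (rule ccontr)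
    assume neg: "\<not> n $ 3 \<ge> 0"
    have "x $ 3 = 0" if "x \<in> F" for x
    proof -
      have x: "x \<in> C" "n \<bullet> x = c" using that Fn by auto
      \<comment> \<open>With \<open>n $ 3\<close> negative, lowering \<open>x\<close> to the base
        would exceed the bound unless its height is already zero.\<close>
      have "n \<bullet> vproj x \<le> c" using C vproj_in[OF x(1)] by blast
      then have "0 \<le> n $ 3 * x $ 3" using x(2) by (simp add: inner_vec3)
      then have "x $ 3 \<le> 0" using neg by (simp add: zero_le_mult_iff)
      then show ?thesis using nonneg[OF x(1)] by simp
    qed
    then have sub: "F \<subseteq> cap_base C" using Fn by (auto simp: cap_base_def)
    have "cap_base C \<noteq> C"
      using not_in_hyperplane[of "axis 3 1" 0] by (auto simp: cap_base_def inner_axis')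
    then have "aff_dim (cap_base C) < 3" using face_of_aff_dim_lt[OF convex_C base_face] dim3 by simp
    \<comment> \<open>A proper face of the base, whose dimension is below 3, would have dimension
      below 2.\<close>
    moreover have "F face_of cap_base C"
      using face_of_subset[OF face(1) sub] base_face face_of_imp_subset by blast
    then have "aff_dim F < aff_dim (cap_base C)"
      using face_of_aff_dim_lt face(3) face_of_imp_convex[OF base_face] by blast
    ultimately show False using face(2) by simp
  qed
  then show ?thesis using that n C Fn by blast
qed

section \<open>Upper facets and their projection\<close>

definition tops :: "(real^3) set set" where
  "tops = {F \<in> nonbase_faces C. \<exists>n c. 0 < n $ 3 \<and> C \<subseteq> {x. n \<bullet> x \<le> c}
      \<and> F = C \<inter> {x. n \<bullet> x = c}}"

text \<open>On a vertical line, an outer normal with positive vertical component bounds the height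
  by that of the facet point.\<close>

lemma tops_max:
  assumes "y \<in> \<Union>tops" "x \<in> C" "shadow x = shadow y"
  shows "x $ 3 \<le> y $ 3"
proof -
  obtain n c where n: "0 < n $ 3" "C \<subseteq> {x. n \<bullet> x \<le> c}" "n \<bullet> y = c"
    using assms(1) unfolding tops_def by blast
  then have "n \<bullet> x \<le> n \<bullet> y" using assms(2) by blast
  then show ?thesis using n(1) assms(3) by (simp add: inner_vec3 shadow_def)
qed

lemma tops_subset: "\<Union>tops \<subseteq> C"
  unfolding tops_def by blast

lemma tops_inj: "inj_on shadow (\<Union>tops)"
proof (rule inj_onI)
  fix x y assume "x \<in> \<Union>tops" "y \<in> \<Union>tops" "shadow x = shadow y"
  then have "x $ 3 = y $ 3" using tops_max[of x y] tops_max[of y x] tops_subset by (metis antisym subsetD)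
  then show "x = y" using \<open>shadow x = shadow y\<close> by (simp add: vec3_eq_iff shadow_def)
qed

lemma interior_vertical:
  assumes "i \<in> interior C"
  obtains e where "e > 0" "i + e *\<^sub>R axis 3 1 \<in> C" "i - e *\<^sub>R axis 3 1 \<in> C"
proof -
  obtain e where e: "e > 0" "ball i e \<subseteq> C" using assms mem_interior by blast
  have "i + (e / 2) *\<^sub>R axis 3 1 \<in> ball i e" "i - (e / 2) *\<^sub>R axis 3 1 \<in> ball i e"
    using e(1) by (simp_all add: dist_norm)
  then show ?thesis using e that[of "e / 2"] by (meson half_gt_zero subsetD)
qed

text \<open>Over an interior point, the highest point of the fibre lies on a facet that is neither
  the base nor vertical. Density of the interior and compactness of the upper facets give the
  remaining points.\<close>

lemma tops_cover: "shadow ` \<Union>tops = shadow ` C"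
proof
  show "shadow ` \<Union>tops \<subseteq> shadow ` C" using tops_subset by blast
  have cont: "continuous_on UNIV shadow"
    using linear_shadow linear_continuous_on linear_conv_bounded_linear by blast
  have main: "shadow i \<in> shadow ` \<Union>tops" if i: "i \<in> interior C" for i
  proof -
    have iC: "i \<in> C" using i interior_subset by blast
    have i3: "i $ 3 > 0"
    proof -
      obtain e where "e > 0" "i - e *\<^sub>R axis 3 1 \<in> C" using interior_vertical[OF i] by metis
      then show ?thesis using nonneg[of "i - e *\<^sub>R axis 3 1"] by (simp add: axis_def)
    qed
    let ?K = "C \<inter> {x. shadow x = shadow i}"
    have "closed {x. shadow x = shadow i}"
      by (intro closed_Collect_eq continuous_on_const cont)
    then have "compact ?K" using compact_C by (rule compact_Int_closed[rotated])
    moreover have "?K \<noteq> {}" using iC by blast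
    moreover have "continuous_on ?K (\<lambda>x. x $ 3)" by (intro continuous_intros)
    ultimately obtain y where y: "y \<in> ?K" "\<And>x. x \<in> ?K \<Longrightarrow> x $ 3 \<le> y $ 3"
      using continuous_attains_sup[of ?K "\<lambda>x. x $ 3"] by blast
    have "y \<notin> interior C"
    proof
      assume "y \<in> interior C"
      then obtain e where e: "e > 0" "y + e *\<^sub>R axis 3 1 \<in> C" using interior_vertical by metis
      then have "y + e *\<^sub>R axis 3 1 \<in> ?K" using y(1) by (simp add: shadow_def axis_def)
      then show False using y(2) e(1) by (force simp: axis_def)
    qed
    then have "y \<in> rel_frontier C"
      using y(1) closure_subset rel_interior_C by (auto simp: rel_frontier_def)
    then obtain F where F: "F facet_of C" "y \<in> F" using rel_frontier_of_polyhedron[OF polyhedron_C]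
        by blast
    have "F \<noteq> cap_base C" using F(2) y(2)[of i] iC i3 by (auto simp: cap_base_def)
    then have Fn: "F \<in> nonbase_faces C" using F(1) nonbase_iff by blast
    then obtain n c where n: "norm n = 1" "C \<subseteq> {x. n \<bullet> x \<le> c}" "F = C \<inter> {x. n \<bullet> x = c}" "n $ 3 \<ge> 0"
      by (rule facet_normal)
    \<comment> \<open>The supporting plane of a vertical facet through \<open>y\<close> would
      contain the interior point \<open>i\<close>.\<close>
    have "n $ 3 \<noteq> 0"
    proof
      assume "n $ 3 = 0"
      then have "n \<bullet> i = n \<bullet> y" using y(1) by (simp add: inner_vec3 shadow_def)
      then have "n \<bullet> i = c" using F(2) n(3) by blast
      moreover have "n \<noteq> 0" using n(1) by auto
      ultimately show False using interior_below[OF _ n(2) i] by simp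
    qed
    then have "0 < n $ 3" using n(4) by simp
    then have "F \<in> tops" using Fn n(2,3) unfolding tops_def by blast
    then have "y \<in> \<Union>tops" using F(2) by (rule UnionI)
    moreover have "shadow i = shadow y" using y(1) by simp
    ultimately show ?thesis by (simp only: imageI)
  qed
  have "finite tops"
    by (rule finite_subset[OF _ finite_polytope_faces[OF poly]]) (auto simp: tops_def nonbase_faces_def)
  moreover have "compact F" if "F \<in> tops" for F
    using that face_of_polytope_polytope[OF poly] polytope_imp_compact
    by (auto simp: tops_def nonbase_faces_def)
  ultimately have "compact (\<Union>tops)" by (rule compact_Union)
  then have "compact (shadow ` \<Union>tops)"
    by (intro compact_continuous_image continuous_on_subset[OF cont]) simp_all
  then have "closed (shadow -` (shadow ` \<Union>tops))"
    by (intro closed_vimage cont compact_imp_closed)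
  moreover have "interior C \<subseteq> shadow -` (shadow ` \<Union>tops)" using main
      by (intro subsetI vimageI2)
  ultimately have "closure (interior C) \<subseteq> shadow -` (shadow ` \<Union>tops)"
      by (rule closure_minimal[rotated])
  moreover have "C \<subseteq> closure (interior C)"
    unfolding convex_closure_interior[OF convex_C interior_nonempty] by (rule closure_subset)
  ultimately show "shadow ` C \<subseteq> shadow ` \<Union>tops"
      by (simp only: image_subset_iff_subset_vimage)
qed

section \<open>Vertical facets\<close>

lemma facet_vertical:
  assumes "F facet_of C" "p \<in> F" "u \<in> F" "shadow p = shadow u" "p \<noteq> u"
  obtains n c where "norm n = 1" "C \<subseteq> {x. n \<bullet> x \<le> c}" "F = C \<inter> {x. n \<bullet> x = c}" "n $ 3 = 0"
    "F \<in> nonbase_faces C"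
proof -
  have "p $ 3 \<noteq> u $ 3" using assms(4,5) by (simp add: vec3_eq_iff shadow_def)
  then have "F \<noteq> cap_base C" using assms(2,3) by (auto simp: cap_base_def)
  then have Fn: "F \<in> nonbase_faces C" using assms(1) nonbase_iff by blast
  then obtain n c where n: "norm n = 1" "C \<subseteq> {x. n \<bullet> x \<le> c}" "F = C \<inter> {x. n \<bullet> x = c}"
    by (rule facet_normal)
  have "n \<bullet> p = n \<bullet> u" using assms(2,3) n(3) by auto
  then have "n $ 3 * (p $ 3 - u $ 3) = 0" using assms(4) by (simp add: inner_vec3 shadow_def algebra_simps)
  then show ?thesis using that[OF n _ Fn] \<open>p $ 3 \<noteq> u $ 3\<close> by simp
qed

text \<open>A vertical facet contains its projection to the base plane. With only one vertex there,
  it would lie in a single vertical line. The two vertices later rule out a rotation of the facet in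
  its plane.\<close>

lemma vertical_base_vertices:
  assumes F: "F \<in> nonbase_faces C" and n: "F = C \<inter> {x. n \<bullet> x = c}" "n $ 3 = 0"
  obtains p q where "p extreme_point_of F" "q extreme_point_of F" "p $ 3 = 0" "q $ 3 = 0" "p \<noteq> q"
proof -
  have face: "F face_of C" "aff_dim F = 2" using F by (auto simp: nonbase_faces_def)
  have polyF: "polytope F" using face_of_polytope_polytope[OF poly face(1)] .
  let ?B = "F \<inter> {x. axis 3 1 \<bullet> x = 0}"
  have B: "?B face_of F"
    using face_of_Int_supporting_hyperplane_ge[OF polytope_imp_convex[OF polyF], of 0 "axis 3 1"] nonneg n(1)
    by (auto simp: inner_axis')
  have vB: "vproj x \<in> ?B" if "x \<in> F" for x
    using that vproj_in n by (auto simp: inner_vec3 axis_def)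
  have KM: "?B = convex hull {x. x extreme_point_of ?B}"
    using Krein_Milman_Minkowski polytope_imp_compact polytope_imp_convex face_of_polytope_polytope[OF polyF B] by blast
  have "\<exists>p q. p extreme_point_of ?B \<and> q extreme_point_of ?B \<and> p \<noteq> q"
  proof (rule ccontr)
    assume "\<not> ?thesis"
    then obtain p where "{x. x extreme_point_of ?B} \<subseteq> {p}" by blast
    then have "convex hull {x. x extreme_point_of ?B} \<subseteq> {p}" by (intro hull_minimal) auto
    then have "?B \<subseteq> {p}" by (simp only: KM[symmetric])
    then have "vproj x = p" if "x \<in> F" for x using vB[OF that] by blast
    then have "shadow x = shadow p" if "x \<in> F" for x using shadow_vproj[of x] that by simp
    then have "F \<subseteq> {x. shadow x = shadow p}" by auto
    then have "collinear F" by (rule collinear_subset[OF collinear_fibre])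
    then show False using face(2) by (simp add: collinear_aff_dim)
  qed
  then obtain p q where pq: "p extreme_point_of ?B" "q extreme_point_of ?B" "p \<noteq> q" by blast
  then have "p extreme_point_of F" "q extreme_point_of F" "p \<in> ?B" "q \<in> ?B"
    using extreme_point_of_face[OF B] by blast+
  then show ?thesis using that pq(3) by (auto simp: inner_axis')
qed

text \<open>Projected to the base, the segment contains \<open>p\<close> in its inside, so
  extremality of \<open>p\<close> collapses the projection to a point.\<close>

lemma fibre_over_base_vertex:
  assumes p: "p extreme_point_of C" "p $ 3 = 0"
    and x: "a \<in> C" "b \<in> C" "x \<in> open_segment a b" "shadow x = shadow p"
  shows "shadow a = shadow p" "shadow b = shadow p"
proof -
  obtain l where l: "0 < l" "l < 1" and xl: "x = (1 - l) *\<^sub>R a + l *\<^sub>R b"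
    using x(3) unfolding in_segment by blast
  have pe: "p = (1 - l) *\<^sub>R vproj a + l *\<^sub>R vproj b"
    using x(4) p(2) unfolding xl by (simp add: vec3_eq_iff shadow_def)
  have ab: "vproj a = vproj b"
  proof (rule ccontr)
    assume "vproj a \<noteq> vproj b"
    then have "p \<in> open_segment (vproj a) (vproj b)" using l pe unfolding in_segment by blast
    then show False using p(1) vproj_in x(1,2) unfolding extreme_point_of_def by blast
  qed
  then have "p = vproj b" using pe by (simp add: algebra_simps)
  then show "shadow a = shadow p" "shadow b = shadow p" using ab shadow_vproj by metis+
qed

text \<open>The fibre over \<open>p\<close> is a face of dimension at most one and equals the
  intersection of the facets containing it, so there are at least two of these. They are vertical
  because they contain both \<open>p\<close> and \<open>u\<close>.\<close>

lemma two_vertical_facets: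
  assumes p: "p extreme_point_of C" "p $ 3 = 0" and u: "u \<in> C" "shadow u = shadow p" "u \<noteq> p"
  obtains F F' n n' c c' where
    "F \<in> nonbase_faces C" "p \<in> F" "u \<in> F" "norm n = 1" "F = C \<inter> {x. n \<bullet> x = c}" "n $ 3 = 0"
    "F' \<in> nonbase_faces C" "p \<in> F'" "u \<in> F'" "norm n' = 1" "F' = C \<inter> {x. n' \<bullet> x = c'}" "n' $ 3 = 0"
    "n $ 1 * n' $ 2 - n $ 2 * n' $ 1 \<noteq> 0"
proof -
  let ?E = "C \<inter> {x. shadow x = shadow p}"
  have pC: "p \<in> C" using p(1) by (simp add: extreme_point_of_def)
  have "{x. shadow x = shadow p} = shadow -` {shadow p}" by blast
  then have "convex ?E"
    using convex_C convex_linear_vimage[OF linear_shadow] by (simp add: convex_Int)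
  then have Eface: "?E face_of C"
    unfolding face_of_def using fibre_over_base_vertex[OF p] by (auto simp: Ball_def)
  have E: "?E \<noteq> {}" "?E \<noteq> C" using pC not_subset_fibre by blast+
  have uE: "p \<in> ?E" "u \<in> ?E" using pC u by auto
  obtain F where F: "F facet_of C" "?E \<subseteq> F"
    using face_of_polyhedron_subset_facet[OF polyhedron_C Eface E] by blast
  have "collinear ?E" by (rule collinear_subset[OF collinear_fibre]) auto
  then have "aff_dim ?E \<le> 1" by (simp add: collinear_aff_dim)
  moreover have "aff_dim F = 2" using F(1) dim3 by (simp add: facet_of_def)
  ultimately have "?E \<noteq> F" by auto
  have "\<exists>F'. F' facet_of C \<and> ?E \<subseteq> F' \<and> F' \<noteq> F"
  proof (rule ccontr)
    assume "\<not> ?thesis"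
    then have "{F. F facet_of C \<and> ?E \<subseteq> F} = {F}" using F by blast
    then have "?E = F" using face_of_polyhedron[OF polyhedron_C Eface E] by simp
    then show False using \<open>?E \<noteq> F\<close> by simp
  qed
  then obtain F' where F': "F' facet_of C" "?E \<subseteq> F'" "F' \<noteq> F" by blast
  obtain n c where n: "norm n = 1" "C \<subseteq> {x. n \<bullet> x \<le> c}" "F = C \<inter> {x. n \<bullet> x = c}" "n $ 3 = 0"
    "F \<in> nonbase_faces C"
    using facet_vertical[OF F(1), of p u] F(2) uE u by auto
  obtain n' c' where n': "norm n' = 1" "C \<subseteq> {x. n' \<bullet> x \<le> c'}" "F' = C \<inter> {x. n' \<bullet> x = c'}" "n' $ 3 = 0"
    "F' \<in> nonbase_faces C"
    using facet_vertical[OF F'(1), of p u] F'(2) uE u by auto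
  have cp: "n \<bullet> p = c" "n' \<bullet> p = c'" using F F' uE n(3) n'(3) by blast+
  have "n $ 1 * n' $ 2 - n $ 2 * n' $ 1 \<noteq> 0"
  proof
    assume det: "n $ 1 * n' $ 2 - n $ 2 * n' $ 1 = 0"
    have sq: "n $ 1 * n $ 1 + n $ 2 * n $ 2 = 1" "n' $ 1 * n' $ 1 + n' $ 2 * n' $ 2 = 1"
      using n(1,4) n'(1,4) by (auto simp: norm_eq_1 inner_vec3)
    define k where "k = n $ 1 * n' $ 1 + n $ 2 * n' $ 2"
    have "n' $ 1 = k * n $ 1" "n' $ 2 = k * n $ 2" using det sq(1) unfolding k_def by algebra+
    then have nk: "n' = k *\<^sub>R n" using n(4) n'(4) by (simp add: vec3_eq_iff)
    \<comment> \<open>Parallel unit normals are equal or opposite: equal ones give the same facet,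
      opposite ones squeeze \<open>C\<close> into a plane.\<close>
    then have "\<bar>k\<bar> = 1" using n(1) n'(1) by simp
    then consider "k = 1" | "k = -1" by linarith
    then show False
    proof cases
      case 1
      then show False using nk cp n(3) n'(3) F'(3) by simp
    next
      case 2
      then have "C \<subseteq> {x. n \<bullet> x = c}" using nk cp subsetD[OF n(2)] subsetD[OF n'(2)]
          by (force intro: antisym)
      moreover have "n \<noteq> 0" using n(1) by auto
      ultimately show False using not_in_hyperplane by blast
    qed
  qed
  then show ?thesis using that[of F n c F' n' c'] n n' F F' uE by blast
qed

end

section \<open>Rigidity\<close>

locale flexed_cap = cap3 C for C :: "(real^3) set" +
  fixes tri :: "(real^3) set \<Rightarrow> (real^3) set set" and v :: "real^3 \<Rightarrow> real^3"
  assumes tri: "diag_triangulation C tri" and flex: "inf_flex C tri v"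
begin

lemma flex_triangle:
  assumes "F \<in> nonbase_faces C" "t \<in> tri F" "p \<in> t" "q \<in> t"
  shows "(v p - v q) \<bullet> (p - q) = 0"
proof (cases "p = q")
  case False
  have "F face_of C" using assms(1) by (simp add: nonbase_faces_def)
  then have "p \<in> cap_vertices C" "q \<in> cap_vertices C"
    using diag_triangulationD(1)[OF tri assms(1,2)] assms(3,4) extreme_point_of_face
    unfolding cap_vertices_def by blast+
  then have "(p, q) \<in> cap_bars C tri" using False assms unfolding cap_bars_def by blast
  then show ?thesis using flex unfolding inf_flex_def by blast
qed simp

lemma base_vertex_horizontal:
  assumes "p extreme_point_of C" "p $ 3 = 0" shows "v p $ 3 = 0"
  using flex assms unfolding inf_flex_def cap_vertices_def by blast

text \<open>The facet is a planar triangulated polygon, so it moves rigidly in its plane. Two base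
  vertices with zero vertical velocity exclude rotation and vertical translation, leaving a
  horizontal slide of speed \<open>s\<close>.\<close>

lemma vertical_facet_rigid:
  assumes F: "F \<in> nonbase_faces C" and n: "norm n = 1" "F = C \<inter> {x. n \<bullet> x = c}" "n $ 3 = 0"
  obtains s where "\<And>p. p extreme_point_of C \<Longrightarrow> p \<in> F \<Longrightarrow>
    v p $ 3 = 0 \<and> n $ 1 * v p $ 2 - n $ 2 * v p $ 1 = s"
proof -
  \<comment> \<open>Orthonormal coordinates of the facet plane: the horizontal direction normal to
    \<open>n\<close>, and the height.\<close>
  define L where "L = (\<lambda>x::real^3. (n $ 1 * x $ 2 - n $ 2 * x $ 1, x $ 3))"
  have L: "linear L" unfolding L_def by (rule linearI) (simp_all add: algebra_simps)
  have sq: "n $ 1 * n $ 1 + n $ 2 * n $ 2 = 1" using n(1,3) by (auto simp: norm_eq_1 inner_vec3)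
  have inj: "inj_on L F"
  proof (rule inj_onI)
    fix x y assume xy: "x \<in> F" "y \<in> F" "L x = L y"
    then have 1: "n $ 1 * x $ 1 + n $ 2 * x $ 2 = n $ 1 * y $ 1 + n $ 2 * y $ 2"
      using n(2,3) by (simp add: inner_vec3)
    have 2: "n $ 1 * x $ 2 - n $ 2 * x $ 1 = n $ 1 * y $ 2 - n $ 2 * y $ 1" "x $ 3 = y $ 3"
      using xy(3) by (simp_all add: L_def)
    have "x $ 1 = y $ 1" "x $ 2 = y $ 2" using 1 2(1) sq by algebra+
    then show "x = y" using 2(2) by (simp add: vec3_eq_iff)
  qed
  have face: "F face_of C" using F by (simp add: nonbase_faces_def)
  have conv: "convex (L ` F)" using face_of_imp_convex[OF face] convex_linear_image[OF L] by blast
  have "{F} \<subseteq> nonbase_faces C" "inj_on L (\<Union>{F})" "convex (L ` \<Union>{F})"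
    using F inj conv by simp_all
  note * = triangulated_region_of_facets[OF poly tri this(1) L this(2,3)]
  interpret triangulated_region L "tri F" using *(1) by simp
  have vert: "p \<in> \<Union>(tri F)" if "p extreme_point_of C" "p \<in> F" for p using *(3) that by auto
  have planar: "(L (v x) - L (v y)) \<bullet> (L x - L y) = 0" if t: "t \<in> tri F" "x \<in> t" "y \<in> t" for t x y
  proof -
    have xy: "x \<in> F" "y \<in> F"
      using diag_triangulationD(1)[OF tri F t(1)] t(2,3) by (auto simp: extreme_point_of_def)
    have 0: "n $ 1 * (x $ 1 - y $ 1) + n $ 2 * (x $ 2 - y $ 2) = 0"
      using xy n(2,3) by (simp add: inner_vec3 algebra_simps)
    have "(v x $ 1 - v y $ 1) * (x $ 1 - y $ 1) + (v x $ 2 - v y $ 2) * (x $ 2 - y $ 2)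
        + (v x $ 3 - v y $ 3) * (x $ 3 - y $ 3) = 0"
      using flex_triangle[OF F t] by (simp add: inner_vec3)
    \<comment> \<open>Since edges are orthogonal to \<open>n\<close>, only the tangential part of
      the horizontal velocity difference enters the inner product.\<close>
    moreover have "(n $ 1 * A - n $ 2 * B) * (n $ 1 * D - n $ 2 * E) = B * E + A * D"
      if "n $ 1 * E + n $ 2 * D = 0" for A B D E
      using that sq by algebra
    note this[OF 0, of "v x $ 2 - v y $ 2" "v x $ 1 - v y $ 1"]
    ultimately show ?thesis unfolding L_def inner_prod_def by (simp add: algebra_simps)
  qed
  have "\<exists>k b. \<forall>p\<in>\<Union>(tri F). L (v p) = b + k *\<^sub>R perp (L p)"
    by (rule flex_rigid) (erule (2) planar)
  then obtain k b where kb: "\<And>p. p \<in> \<Union>(tri F)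
      \<Longrightarrow> L (v p) = b + k *\<^sub>R perp (L p)"
    by blast
  have v3: "v p $ 3 = snd b + k * fst (L p)" "n $ 1 * v p $ 2 - n $ 2 * v p $ 1 = fst b - k * p $ 3"
    if "p extreme_point_of C" "p \<in> F" for p
    using kb[OF vert[OF that]] by (simp_all add: L_def perp_def prod_eq_iff)
  obtain p q where pq: "p extreme_point_of F" "q extreme_point_of F" "p $ 3 = 0" "q $ 3 = 0" "p \<noteq> q"
    using vertical_base_vertices[OF F n(2,3)] by blast
  then have pqC: "p extreme_point_of C" "p \<in> F" "q extreme_point_of C" "q \<in> F"
    using extreme_point_of_face[OF face] by blast+
  have "L p \<noteq> L q" using inj_onD[OF inj _ pqC(2,4)] pq(5) by blast
  then have "fst (L p) \<noteq> fst (L q)" using pq(3,4) by (auto simp: L_def)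
  \<comment> \<open>The vertical velocity depends affinely on the horizontal coordinate, with slope
    \<open>k\<close>, and vanishes at two different places.\<close>
  moreover have "snd b + k * fst (L p) = 0" "snd b + k * fst (L q) = 0"
    using v3(1) base_vertex_horizontal pqC pq(3,4) by metis+
  then have "k * (fst (L p) - fst (L q)) = 0" unfolding right_diff_distrib by linarith
  ultimately have "k = 0" by simp
  then have "snd b = 0" using \<open>snd b + k * fst (L p) = 0\<close> by simp
  show ?thesis
    using that[of "fst b"] v3 \<open>k = 0\<close> \<open>snd b = 0\<close> by simp
qed

text \<open>A supporting line of the shadow lifts to a vertical supporting plane of
  \<open>C\<close>. If \<open>p\<close> is above the base, a facet containing both \<open>p\<close>
  and \<open>vproj p\<close> is vertical, and such facets move horizontally.\<close>

lemma boundary_vertex_horizontal: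
  assumes p: "p extreme_point_of C" and a: "a \<noteq> 0" "\<And>y. y \<in> shadow ` C
      \<Longrightarrow> a \<bullet> y \<le> a \<bullet> shadow p"
  shows "v p $ 3 = 0"
proof (cases "p $ 3 = 0")
  case True then show ?thesis using base_vertex_horizontal p by blast
next
  case False
  have pC: "p \<in> C" using p by (simp add: extreme_point_of_def)
  \<comment> \<open>The horizontal lift of \<open>a\<close>, normal to the vertical plane over the
    supporting line.\<close>
  define m :: "real^3" where "m = vector [fst a, snd a, 0]"
  have m: "m \<bullet> x = a \<bullet> shadow x" for x
      by (simp add: m_def inner_vec3 shadow_def inner_prod_def)
  have "m \<noteq> 0" using a(1) by (auto simp: m_def vec3_eq_iff prod_eq_iff)
  let ?G = "C \<inter> {x. m \<bullet> x = m \<bullet> p}"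
  have G: "?G face_of C"
    using a(2) by (intro face_of_Int_supporting_hyperplane_le convex_C) (simp add: m)
  have "p \<in> ?G" "vproj p \<in> ?G" using pC vproj_in by (auto simp: m shadow_vproj)
  moreover have "?G \<noteq> C" using not_in_hyperplane[OF \<open>m \<noteq> 0\<close>] by blast
  moreover have "?G \<noteq> {}" using \<open>p \<in> ?G\<close> by blast
  ultimately obtain F where "F facet_of C" "?G \<subseteq> F"
    using face_of_polyhedron_subset_facet[OF polyhedron_C G] by metis
  then have F: "F facet_of C" "p \<in> F" "vproj p \<in> F"
    using \<open>p \<in> ?G\<close> \<open>vproj p \<in> ?G\<close> by blast+
  have "p \<noteq> vproj p" using False by (metis vproj_nth(3))
  then obtain n c where n: "norm n = 1" "F = C \<inter> {x. n \<bullet> x = c}" "n $ 3 = 0" "F \<in> nonbase_faces C"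
    using facet_vertical[OF F] shadow_vproj by metis
  show ?thesis using vertical_facet_rigid[OF n(4,1,2,3)] p F(2) by metis
qed

section \<open>The flex on the upper surface\<close>

definition top_triangles :: "(real^3) set set" where "top_triangles = (\<Union>F\<in>tops. tri F)"

lemma tops_nonbase: "tops \<subseteq> nonbase_faces C" by (auto simp: tops_def)

lemma convex_shadow: "convex (shadow ` \<Union>tops)"
  unfolding tops_cover by (rule convex_linear_image[OF linear_shadow convex_C])

lemmas top_triangulation =
  triangulated_region_of_facets[OF poly tri tops_nonbase linear_shadow tops_inj convex_shadow, folded top_triangles_def]

text \<open>The inequality of the supporting plane is solved for the height. It is stated for all
  points of the triangle and of \<open>C\<close>, not only vertices, because \<open>strict\<close>
  concerns such points.\<close>

lemma top_gradient:
  assumes "t \<in> top_triangles"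
  shows "\<exists>g. \<forall>p \<in> convex hull t. \<forall>q\<in>C. q $ 3 \<le> p $ 3 + g \<bullet> (shadow q - shadow p)"
proof -
  obtain F where F: "F \<in> tops" "t \<in> tri F" using assms unfolding top_triangles_def by blast
  obtain n c where n: "0 < n $ 3" "C \<subseteq> {x. n \<bullet> x \<le> c}" "F = C \<inter> {x. n \<bullet> x = c}"
    using F(1) unfolding tops_def by blast
  have tF: "convex hull t \<subseteq> F"
    using diag_triangulationD(3)[OF tri subsetD[OF tops_nonbase F(1)]] F(2) by blast
  have "q $ 3 \<le> p $ 3 + (- n $ 1 / n $ 3, - n $ 2 / n $ 3) \<bullet> (shadow q - shadow p)"
    if "p \<in> convex hull t" "q \<in> C" for p q
  proof -
    have "n \<bullet> q \<le> n \<bullet> p" using that tF n by blast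
    then have "(q $ 3 - p $ 3) * n $ 3 \<le> - n $ 1 * (q $ 1 - p $ 1) + - n $ 2 * (q $ 2 - p $ 2)"
      by (simp add: inner_vec3 algebra_simps)
    then have "q $ 3 - p $ 3 \<le> (- n $ 1 * (q $ 1 - p $ 1) + - n $ 2 * (q $ 2 - p $ 2)) / n $ 3"
      using n(1) by (simp only: pos_le_divide_eq)
    then show ?thesis by (simp add: inner_prod_def shadow_def add_divide_distrib diff_divide_distrib)
  qed
  then show ?thesis by blast
qed

lemma top_hull_subset: "t \<in> top_triangles \<Longrightarrow> convex hull t \<subseteq> C"
proof -
  assume "t \<in> top_triangles"
  then obtain F where F: "F \<in> tops" "t \<in> tri F" unfolding top_triangles_def by blast
  have "convex hull t \<subseteq> F"
    using diag_triangulationD(3)[OF tri subsetD[OF tops_nonbase F(1)]] F(2) by blast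
  then show ?thesis using tops_subset F(1) by blast
qed

lemma flex_top:
  assumes "t \<in> top_triangles" "p \<in> t" "q \<in> t"
  shows "(shadow (v p) - shadow (v q)) \<bullet> (shadow p - shadow q) + (v p $ 3 - v q $ 3) * (p $ 3 - q $ 3) = 0"
proof -
  obtain F where "F \<in> nonbase_faces C" "t \<in> tri F" using assms(1) tops_nonbase
      unfolding top_triangles_def by blast
  from flex_triangle[OF this assms(2,3)] show ?thesis
    by (simp add: inner_vec3 inner_prod_def shadow_def)
qed

text \<open>The upper surface is an instance of \<open>concave_surface\<close>: facet planes give
  \<open>below\<close>, extremality of the vertices gives \<open>strict\<close>, and vertical facets
  give the boundary condition.\<close>

lemma top_vertex_horizontal:
  assumes p: "p \<in> \<Union>top_triangles"
  shows "v p $ 3 = 0"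
proof -
  obtain G where G: "\<And>t p q. t \<in> top_triangles \<Longrightarrow> p \<in> convex hull t
      \<Longrightarrow> q \<in> C \<Longrightarrow> q $ 3 \<le> p $ 3 + G t \<bullet> (shadow q - shadow p)"
    using top_gradient by metis
  interpret triangulated_region shadow top_triangles by (rule top_triangulation(1))
  have reg: "region = shadow ` C"
    unfolding region_def using top_triangulation(2) tops_cover by simp
  have ext: "q extreme_point_of C" "q \<in> C" if "q \<in> \<Union>top_triangles" for q
    using that top_triangulation(3) tops_subset by auto
  interpret concave_surface shadow top_triangles "\<lambda>x. x $ 3" G
  proof
    fix t p q assume "t \<in> top_triangles" "p \<in> t" "q \<in> \<Union>top_triangles"
    then show "q $ 3 \<le> p $ 3 + G t \<bullet> (shadow q - shadow p)" using G hull_inc ext(2) by metis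
  next
    fix t t' p x x'
    assume t: "t \<in> top_triangles" "t' \<in> top_triangles" "p \<in> t" "p \<in> t'" "G t = G t'"
      and x: "x \<in> convex hull (shadow ` t)" "x' \<in> convex hull (shadow ` t')" "shadow p = midpoint x x'"
    have hullL: "convex hull (shadow ` s) = shadow ` (convex hull s)" for s
      by (simp add: convex_hull_linear_image[OF linear_shadow])
    obtain y where y: "y \<in> convex hull t" "x = shadow y" using x(1) hullL by blast
    obtain y' where y': "y' \<in> convex hull t'" "x' = shadow y'" using x(2) hullL by blast
    have yC: "y \<in> C" "y' \<in> C" using top_hull_subset t y y' by blast+
    have pT: "p \<in> \<Union>top_triangles" "p \<in> convex hull t" "p \<in> convex hull t'" using t
        by (auto intro: hull_inc)
    have d: "shadow y' - shadow p = - (shadow y - shadow p)"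
      using x(3) y(2) y'(2) by (simp add: midpoint_def prod_eq_iff)
    \<comment> \<open>Both points lie on the plane through \<open>p\<close> with the common
      gradient, so opposite shadows about \<open>p\<close> make \<open>p\<close> their midpoint in
      space.\<close>
    have "y $ 3 = p $ 3 + G t \<bullet> (shadow y - shadow p)"
      using G[OF t(1) pT(2) yC(1)] G[OF t(1) y(1) ext(2)[OF pT(1)]] by (simp add: inner_diff_right)
    moreover have "y' $ 3 = p $ 3 + G t \<bullet> (shadow y' - shadow p)"
      using G[OF t(2) pT(3) yC(2)] G[OF t(2) y'(1) ext(2)[OF pT(1)]] t(5) by (simp add: inner_diff_right)
    ultimately have "y $ 3 + y' $ 3 = 2 * p $ 3" unfolding d inner_minus_right by simp
    moreover have "y $ 1 + y' $ 1 = 2 * p $ 1" "y $ 2 + y' $ 2 = 2 * p $ 2"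
      using d by (simp_all add: shadow_def prod_eq_iff)
    ultimately have "p = midpoint y y'" by (simp add: vec3_eq_iff midpoint_def)
    then have "y = y'"
      using ext(1)[OF pT(1)] yC unfolding extreme_point_of_def by (metis midpoint_in_open_segment)
    then show "x = x'" using y(2) y'(2) by simp
  qed
  show ?thesis
  proof (rule height_zero[of "\<lambda>x. shadow (v x)" "\<lambda>x. v x $ 3", OF _ _ p])
    fix t p q assume "t \<in> top_triangles" "p \<in> t" "q \<in> t"
    then show "(shadow (v p) - shadow (v q)) \<bullet> (shadow p - shadow q) + (v p $ 3 - v q $ 3) * (p $ 3 - q $ 3) = 0"
      by (rule flex_top)
  next
    fix p a assume "p \<in> \<Union>top_triangles" "a \<noteq> 0" "\<And>y. y \<in> region
        \<Longrightarrow> a \<bullet> y \<le> a \<bullet> shadow p"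
    then show "v p $ 3 = 0" using boundary_vertex_horizontal[of p a] ext(1) reg by blast
  qed
qed

lemma top_rigid: "\<exists>k b. \<forall>p\<in>\<Union>top_triangles. shadow (v p) = b + k *\<^sub>R perp (shadow p)"
proof -
  interpret triangulated_region shadow top_triangles by (rule top_triangulation(1))
  have planar: "(shadow (v x) - shadow (v y)) \<bullet> (shadow x - shadow y) = 0" if "t \<in> top_triangles" "x \<in> t" "y \<in> t" for t x y
  proof -
    have "v x $ 3 = 0" "v y $ 3 = 0" using top_vertex_horizontal that by blast+
    then show ?thesis using flex_top[OF that] by simp
  qed
  show ?thesis by (rule flex_rigid) (erule (2) planar)
qed

text \<open>A vertex off the upper surface is a base vertex below an upper vertex \<open>u\<close>.
  Two vertical facets through both, with independent normals, each equate one horizontal velocity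
  component, so \<open>p\<close> and \<open>u\<close> move alike.\<close>

lemma vertex_below_top:
  assumes p: "p extreme_point_of C"
  obtains u where "u \<in> \<Union>top_triangles" "shadow u = shadow p" "v p = v u"
proof -
  have pC: "p \<in> C" using p by (simp add: extreme_point_of_def)
  then obtain u where u: "u \<in> \<Union>tops" "shadow u = shadow p" using tops_cover
      by (metis imageE imageI)
  have uC: "u \<in> C" using u(1) tops_subset by blast
  show thesis
  proof (cases "u = p")
    case True
    then have "p \<in> \<Union>top_triangles" using u(1) p top_triangulation(3) by auto
    then show ?thesis using that by blast
  next
    case False
    have lt: "p $ 3 < u $ 3"
      using tops_max[OF u(1) pC] u(2) False by (fastforce simp: vec3_eq_iff shadow_def)
    \<comment> \<open>Otherwise \<open>p\<close> would lie strictly between \<open>vproj u\<close>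
      and \<open>u\<close>.\<close>
    have p3: "p $ 3 = 0"
    proof (rule ccontr)
      assume "p $ 3 \<noteq> 0"
      then have pos: "0 < p $ 3" using nonneg[OF pC] by simp
      define l where "l = p $ 3 / u $ 3"
      have l: "0 < l" "l < 1" using pos lt by (simp_all add: l_def)
      have "p = (1 - l) *\<^sub>R vproj u + l *\<^sub>R u"
        using u(2) pos lt by (simp add: vec3_eq_iff shadow_def l_def algebra_simps)
      moreover have "vproj u \<noteq> u" using lt pos by (metis vproj_nth(3) less_asym less_trans)
      ultimately have "p \<in> open_segment (vproj u) u" using l unfolding in_segment by blast
      then show False using p vproj_in[OF uC] uC unfolding extreme_point_of_def by blast
    qed
    \<comment> \<open>A segment through \<open>u\<close> stays in the vertical line over the base
      vertex \<open>p\<close>, where \<open>u\<close> is the highest point, so it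
      degenerates.\<close>
    have uext: "u extreme_point_of C"
      unfolding extreme_point_of_def
    proof (intro conjI ballI notI uC)
      fix a b assume ab: "a \<in> C" "b \<in> C" "u \<in> open_segment a b"
      have sh: "shadow a = shadow u" "shadow b = shadow u"
        using fibre_over_base_vertex[OF p p3 ab u(2)] u(2) by simp_all
      obtain l where l: "0 < l" "l < 1" and ul: "u = (1 - l) *\<^sub>R a + l *\<^sub>R b"
        using ab(3) unfolding in_segment by blast
      have le: "a $ 3 \<le> u $ 3" "b $ 3 \<le> u $ 3" using tops_max[OF u(1)] ab sh by blast+
      have "(1 - l) * (u $ 3 - a $ 3) + l * (u $ 3 - b $ 3) = 0"
        using arg_cong[OF ul, of "\<lambda>x. x $ 3"] by (simp add: algebra_simps)
      moreover have "0 \<le> (1 - l) * (u $ 3 - a $ 3)" "0 \<le> l * (u $ 3 - b $ 3)" using l le by simp_all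
      ultimately have "(1 - l) * (u $ 3 - a $ 3) = 0" "l * (u $ 3 - b $ 3) = 0" by linarith+
      then have "a $ 3 = b $ 3" using l by simp
      then have "a = b" using sh by (simp add: vec3_eq_iff shadow_def)
      then show False using ab(3) by simp
    qed
    then have uT: "u \<in> \<Union>top_triangles" using u(1) top_triangulation(3) by auto
    obtain F F' n n' c c' where
      F: "F \<in> nonbase_faces C" "norm n = 1" "F = C \<inter> {x. n \<bullet> x = c}" "n $ 3 = 0" and
      F': "F' \<in> nonbase_faces C" "norm n' = 1" "F' = C \<inter> {x. n' \<bullet> x = c'}" "n' $ 3 = 0" and
      det: "n $ 1 * n' $ 2 - n $ 2 * n' $ 1 \<noteq> 0" and
      mem: "p \<in> F" "u \<in> F" "p \<in> F'" "u \<in> F'"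
      using two_vertical_facets[OF p p3 uC u(2) False] by metis
    have 1: "n $ 1 * v p $ 2 - n $ 2 * v p $ 1 = n $ 1 * v u $ 2 - n $ 2 * v u $ 1"
      using vertical_facet_rigid[OF F] p uext mem by metis
    have 2: "n' $ 1 * v p $ 2 - n' $ 2 * v p $ 1 = n' $ 1 * v u $ 2 - n' $ 2 * v u $ 1"
      using vertical_facet_rigid[OF F'] p uext mem by metis
    \<comment> \<open>Cramer's rule for the two tangential equations.\<close>
    have "(n $ 1 * n' $ 2 - n $ 2 * n' $ 1) * (v p $ 1 - v u $ 1) = 0"
      "(n $ 1 * n' $ 2 - n $ 2 * n' $ 1) * (v p $ 2 - v u $ 2) = 0"
      using 1 2 by algebra+
    then have "v p $ 1 = v u $ 1" "v p $ 2 = v u $ 2" using det by simp_all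
    moreover have "v p $ 3 = 0" "v u $ 3 = 0"
      using base_vertex_horizontal[OF p p3] top_vertex_horizontal[OF uT] by simp_all
    ultimately have "v p = v u" by (simp add: vec3_eq_iff)
    then show ?thesis using that uT u(2) by blast
  qed
qed

lemma rigid: "\<exists>m. horiz_rigid_motion m \<and> (\<forall>p\<in>cap_vertices C. v p = m p)"
proof -
  obtain k b where kb: "\<And>p. p \<in> \<Union>top_triangles
      \<Longrightarrow> shadow (v p) = b + k *\<^sub>R perp (shadow p)"
    using top_rigid by blast
  \<comment> \<open>Rotation about the vertical axis: the horizontal part of
    \<open>cross3 A p\<close> is \<open>k *\<^sub>R perp (shadow p)\<close>.\<close>
  define A :: "real^3" where "A = vector [0, 0, k]"
  define D :: "real^3" where "D = vector [fst b, snd b, 0]"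
  have AD: "A $ 1 = 0" "A $ 2 = 0" "A $ 3 = k" "D $ 1 = fst b" "D $ 2 = snd b" "D $ 3 = 0"
    by (simp_all add: A_def D_def)
  have "v p = cross3 A p + D" if "p \<in> cap_vertices C" for p
  proof -
    have "p extreme_point_of C" using that by (simp add: cap_vertices_def)
    then obtain u where u: "u \<in> \<Union>top_triangles" "shadow u = shadow p" "v p = v u"
        by (rule vertex_below_top)
    have "shadow (v p) = b + k *\<^sub>R perp (shadow p)" using kb[OF u(1)] u(2,3) by simp
    moreover have "v p $ 3 = 0" using top_vertex_horizontal[OF u(1)] u(3) by simp
    ultimately show ?thesis
      by (simp add: vec3_eq_iff cross3_def AD shadow_def perp_def prod_eq_iff)
  qed
  then show ?thesis unfolding horiz_rigid_motion_def
    using AD by (intro exI[of _ "\<lambda>p. cross3 A p + D"]) blast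
qed

end

theorem theorem4p10:
  fixes C :: "(real^3) set"
    and tri :: "(real^3) set \<Rightarrow> (real^3) set set"
    and v :: "real^3 \<Rightarrow> real^3"
  assumes "convex_cap C"
    and "aff_dim C = 3"
    and "diag_triangulation C tri"
    and "inf_flex C tri v"
  shows "\<exists>m. horiz_rigid_motion m \<and> (\<forall>p \<in> cap_vertices C. v p = m p)"
proof -
  interpret flexed_cap C tri v using assms by unfold_locales
  show ?thesis by (rule rigid)
qed

end
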